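(* Let $X$ be a second-countable locally compact Hausdorff space of finite topological dimension, and let $V\to X$ be a vector bundle of rank $n$. \begin{enumerate} \item[(a)] There exists a vector bundle $\tilde V$ of rank $n$ over the Stone--Čech compactification $\beta X$ such that $V\cong \tilde V|_X$. \item[(b)] There is a metrisable compactification $X^c$ of $X$ and a vector bundle $V^c\to X^c$ such that $V\cong V^c|_X$. \end{enumerate}
   Context: A vector bundle over a locally compact Hausdorff space means a locally trivial finite-rank complex vector bundle equipped with a continuous family of inner products on the fibres. Topological dimension means covering dimension. *)

theory Defs
  imports "HOL-Analysis.Analysis" "HOL-Algebra.Module"
begin

section \<open>Finite covering dimension\<close>

text \<open>
  Lebesgue covering dimension, with arbitrary open covers. For paracompact Hausdorff spaces, in
  particular for second-countable locally compact Hausdorff spaces, it agrees with the variant that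
  only considers finite open covers.
\<close>

definition covering_dim_le :: "'a topology \<Rightarrow> nat \<Rightarrow> bool" where
  "covering_dim_le X d \<longleftrightarrow>
     (\<forall>\<U>. (\<forall>U\<in>\<U>. openin X U) \<and> \<Union>\<U> = topspace X \<longrightarrow>
        (\<exists>\<V>. (\<forall>V\<in>\<V>. openin X V) \<and> \<Union>\<V> = topspace X \<and>
             (\<forall>V\<in>\<V>. \<exists>U\<in>\<U>. V \<subseteq> U) \<and>
             (\<forall>x\<in>topspace X. finite {V\<in>\<V>. x \<in> V} \<and> card {V\<in>\<V>. x \<in> V} \<le> d + 1)))"

definition finite_covering_dim :: "'a topology \<Rightarrow> bool" where
  "finite_covering_dim X \<longleftrightarrow> (\<exists>d. covering_dim_le X d)"


section \<open>Compactifications\<close>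

definition compactification :: "'a topology \<Rightarrow> 'b topology \<Rightarrow> ('a \<Rightarrow> 'b) \<Rightarrow> bool" where
  "compactification X K e \<longleftrightarrow>
     compact_space K \<and> Hausdorff_space K \<and> embedding_map X K e \<and>
     K closure_of (e ` topspace X) = topspace K"

text \<open>
  The Stone--Cech compactification as the closure of the image of \<open>X\<close> in the cube indexed by
  all continuous functions \<open>X \<rightarrow> [0,1]\<close>. These functions are taken to be extensional, so that each
  of them contributes exactly one coordinate.
\<close>

definition unit_functions :: "'a topology \<Rightarrow> ('a \<Rightarrow> real) set" where
  "unit_functions X =
     {f. continuous_map X (top_of_set {0..1}) f \<and> f \<in> extensional (topspace X)}"

definition stone_cech_cube :: "'a topology \<Rightarrow> (('a \<Rightarrow> real) \<Rightarrow> real) topology" where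
  "stone_cech_cube X = product_topology (\<lambda>f. top_of_set {0..1}) (unit_functions X)"

definition stone_cech_map :: "'a topology \<Rightarrow> 'a \<Rightarrow> (('a \<Rightarrow> real) \<Rightarrow> real)" where
  "stone_cech_map X x = (\<lambda>f\<in>unit_functions X. f x)"

definition stone_cech :: "'a topology \<Rightarrow> (('a \<Rightarrow> real) \<Rightarrow> real) topology" where
  "stone_cech X =
     subtopology (stone_cech_cube X) (stone_cech_cube X closure_of (stone_cech_map X ` topspace X))"


text \<open>
  For completely regular Hausdorff spaces this is a compactification with the universal property
  of the Stone--Cech compactification.
\<close>

lemma stone_cech_map_embedding:
  assumes "completely_regular_space X" "Hausdorff_space X"
  shows "embedding_map X (stone_cech_cube X) (stone_cech_map X)"
proof -
  have eq: "unit_functions X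
      = mspace (submetric (cfunspace X euclidean_metric) {f. f \<in> topspace X \<rightarrow> {0..1}})"
    by (force simp: unit_functions_def continuous_map_in_subtopology
        intro: bounded_subset[OF bounded_closed_interval[of 0 1]])
  show ?thesis
    using completely_regular_space_cube_embedding_explicit[OF assms]
    unfolding stone_cech_cube_def stone_cech_map_def eq .
qed

lemma compact_Hausdorff_stone_cech_cube:
  "compact_space (stone_cech_cube X)" "Hausdorff_space (stone_cech_cube X)"
  unfolding stone_cech_cube_def
  by (simp_all add: compact_space_product_topology Hausdorff_space_product_topology
      compact_space_subtopology Hausdorff_space_subtopology)

lemma compact_Hausdorff_stone_cech:
  "compact_space (stone_cech X)" "Hausdorff_space (stone_cech X)"
  unfolding stone_cech_def
  by (simp_all add: compact_Hausdorff_stone_cech_cube Hausdorff_space_subtopology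
      closedin_compact_space compact_space_subtopology)

lemma compactification_stone_cech:
  assumes "completely_regular_space X" "Hausdorff_space X"
  shows "compactification X (stone_cech X) (stone_cech_map X)"
proof -
  let ?Q = "stone_cech_cube X" and ?S = "stone_cech_map X ` topspace X"
  have emb: "embedding_map X ?Q (stone_cech_map X)"
    by (rule stone_cech_map_embedding[OF assms])
  then have sub: "?S \<subseteq> topspace ?Q"
    by (metis continuous_map_image_subset_topspace embedding_map_def homeomorphic_imp_continuous_map
        continuous_map_in_subtopology)
  then have sub': "?S \<subseteq> ?Q closure_of ?S"
    by (rule closure_of_subset)
  have "embedding_map X (stone_cech X) (stone_cech_map X)"
    unfolding stone_cech_def using emb sub' by (simp add: embedding_map_in_subtopology)
  moreover have "(stone_cech X) closure_of ?S = topspace (stone_cech X)"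
    unfolding stone_cech_def using sub' closure_of_subset_topspace
    by (metis closure_of_subtopology inf.absorb_iff2 inf.idem topspace_subtopology_subset)
  ultimately show ?thesis
    unfolding compactification_def using compact_Hausdorff_stone_cech by blast
qed

lemma stone_cech_extension:
  fixes X :: "'a topology" and K :: "'b topology"
  assumes K: "compact_space K" "Hausdorff_space K" and g: "continuous_map X K g"
  obtains h where "continuous_map (stone_cech X) K h"
    and "\<And>x. x \<in> topspace X \<Longrightarrow> h (stone_cech_map X x) = g x"
proof -
  define G :: "(('a \<Rightarrow> real) \<Rightarrow> real) \<Rightarrow> (('b \<Rightarrow> real) \<Rightarrow> real)"
    where "G y = (\<lambda>f\<in>unit_functions K. y (restrict (f \<circ> g) (topspace X)))" for y
  let ?S = "stone_cech_map X ` topspace X"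
  have mem: "restrict (f \<circ> g) (topspace X) \<in> unit_functions X" if "f \<in> unit_functions K" for f
  proof -
    have "continuous_map X (top_of_set {0..1}) (f \<circ> g)"
      using that g by (auto simp: unit_functions_def intro: continuous_map_compose)
    then show ?thesis
      by (auto simp: unit_functions_def intro: continuous_map_eq)
  qed
  have contG: "continuous_map (stone_cech_cube X) (stone_cech_cube K) G"
    unfolding stone_cech_cube_def continuous_map_componentwise
  proof (intro conjI ballI)
    show "G ` topspace (product_topology (\<lambda>f. top_of_set {0..1}) (unit_functions X))
        \<subseteq> extensional (unit_functions K)"
      by (auto simp: G_def)
    fix f assume f: "f \<in> unit_functions K"
    show "continuous_map (product_topology (\<lambda>f. top_of_set {0..1}) (unit_functions X))
        (top_of_set {0..1}) (\<lambda>y. G y f)"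
      using continuous_map_product_projection[OF mem[OF f], of "\<lambda>f. top_of_set {0..1::real}"] f
      by (simp add: G_def)
  qed
  have Gx: "G (stone_cech_map X x) = stone_cech_map K (g x)" if "x \<in> topspace X" for x
    using that mem by (auto simp: G_def stone_cech_map_def fun_eq_iff)
  have "completely_regular_space K"
    using K by (simp add: compact_Hausdorff_or_regular_imp_normal_space
        normal_imp_completely_regular_space)
  then have emb: "embedding_map K (stone_cech_cube K) (stone_cech_map K)"
    by (rule stone_cech_map_embedding[OF _ K(2)])
  let ?T = "stone_cech_map K ` topspace K"
  obtain k where k: "homeomorphic_maps K (subtopology (stone_cech_cube K) ?T) (stone_cech_map K) k"
    using emb unfolding embedding_map_def homeomorphic_map_maps by blast
  have "continuous_map K (stone_cech_cube K) (stone_cech_map K)"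
    using k unfolding homeomorphic_maps_def continuous_map_in_subtopology by blast
  then have "compactin (stone_cech_cube K) ?T"
    using K(1) image_compactin compact_space_def by blast
  then have clo: "closedin (stone_cech_cube K) ?T"
    using compactin_imp_closedin compact_Hausdorff_stone_cech_cube by blast
  have gK: "g ` topspace X \<subseteq> topspace K"
    using g by (simp add: continuous_map_image_subset_topspace)
  have "G ` ?S \<subseteq> ?T"
    using Gx gK by auto
  then have sub: "G ` (stone_cech_cube X closure_of ?S) \<subseteq> ?T"
    by (meson clo closure_of_minimal contG continuous_map_image_closure_subset order_trans)
  have "continuous_map (stone_cech X) (subtopology (stone_cech_cube K) ?T) G"
    unfolding stone_cech_def continuous_map_in_subtopology
    using contG sub by (auto simp: continuous_map_from_subtopology)
  moreover have "continuous_map (subtopology (stone_cech_cube K) ?T) K k"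
    using k unfolding homeomorphic_maps_def by blast
  ultimately have "continuous_map (stone_cech X) K (k \<circ> G)"
    using continuous_map_compose by blast
  moreover have "(k \<circ> G) (stone_cech_map X x) = g x" if "x \<in> topspace X" for x
    using k gK that Gx unfolding homeomorphic_maps_def by auto
  ultimately show thesis
    using that by blast
qed


section \<open>Vector bundles\<close>

definition complex_ring :: "complex ring" where
  "complex_ring = \<lparr>carrier = UNIV, mult = (*), one = 1, zero = 0, add = (+)\<rparr>"

text \<open>
  The algebraic operations of a bundle are given on the whole total space, but they are
  only meaningful for vectors in a common fibre.
\<close>

record ('b, 'e) vbundle =
  total :: "'e topology"
  proj :: "'e \<Rightarrow> 'b"
  vzero :: "'b \<Rightarrow> 'e"
  vadd :: "'e \<Rightarrow> 'e \<Rightarrow> 'e"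
  vscale :: "complex \<Rightarrow> 'e \<Rightarrow> 'e"
  vinner :: "'e \<Rightarrow> 'e \<Rightarrow> complex"

definition fibre :: "('b, 'e) vbundle \<Rightarrow> 'b \<Rightarrow> 'e set" where
  "fibre E x = {u \<in> topspace (total E). proj E u = x}"

text \<open>The multiplicative fields of the record play no role in a module.\<close>

definition fibre_module :: "('b, 'e) vbundle \<Rightarrow> 'b \<Rightarrow> (complex, 'e) module" where
  "fibre_module E x =
     \<lparr>carrier = fibre E x, mult = undefined, one = undefined,
      zero = vzero E x, add = vadd E, smult = vscale E\<rparr>"

text \<open>Inner products are linear in the first variable.\<close>

definition inner_product_on_fibre :: "('b, 'e) vbundle \<Rightarrow> 'b \<Rightarrow> bool" where
  "inner_product_on_fibre E x \<longleftrightarrow>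
     (\<forall>u\<in>fibre E x. \<forall>v\<in>fibre E x. \<forall>w\<in>fibre E x.
        vinner E (vadd E u v) w = vinner E u w + vinner E v w) \<and>
     (\<forall>c. \<forall>u\<in>fibre E x. \<forall>v\<in>fibre E x. vinner E (vscale E c u) v = c * vinner E u v) \<and>
     (\<forall>u\<in>fibre E x. \<forall>v\<in>fibre E x. vinner E v u = cnj (vinner E u v)) \<and>
     (\<forall>u\<in>fibre E x. u \<noteq> vzero E x \<longrightarrow> 0 < Re (vinner E u u))"

text \<open>The space \<open>\<complex>\<^sup>k\<close>, realised by the extensional functions on \<open>{..<k}\<close>.\<close>

definition complex_space :: "nat \<Rightarrow> (nat \<Rightarrow> complex) topology" where
  "complex_space k = product_topology (\<lambda>_. euclidean) {..<k}"

definition local_trivialization ::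
    "'b topology \<Rightarrow> ('b, 'e) vbundle \<Rightarrow> 'b set \<Rightarrow> nat \<Rightarrow> ('e \<Rightarrow> 'b \<times> (nat \<Rightarrow> complex)) \<Rightarrow> bool" where
  "local_trivialization B E U k \<phi> \<longleftrightarrow>
     homeomorphic_map (subtopology (total E) {u. proj E u \<in> U})
       (prod_topology (subtopology B U) (complex_space k)) \<phi> \<and>
     (\<forall>x\<in>U. \<forall>u\<in>fibre E x. fst (\<phi> u) = x) \<and>
     (\<forall>x\<in>U. \<forall>u\<in>fibre E x. \<forall>v\<in>fibre E x. \<forall>i<k.
        snd (\<phi> (vadd E u v)) i = snd (\<phi> u) i + snd (\<phi> v) i) \<and>
     (\<forall>x\<in>U. \<forall>c. \<forall>u\<in>fibre E x. \<forall>i<k. snd (\<phi> (vscale E c u)) i = c * snd (\<phi> u) i)"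

definition locally_trivial_at :: "'b topology \<Rightarrow> ('b, 'e) vbundle \<Rightarrow> nat \<Rightarrow> 'b \<Rightarrow> bool" where
  "locally_trivial_at B E k x \<longleftrightarrow>
     (\<exists>U \<phi>. openin B U \<and> x \<in> U \<and> local_trivialization B E U k \<phi>)"

text \<open>
  In a vector bundle the dimension of the fibres may vary from one component of the base to another.
  The continuity of the family of inner products is continuity on the fibre product of the
  total space with itself.
\<close>

definition vector_bundle :: "'b topology \<Rightarrow> ('b, 'e) vbundle \<Rightarrow> bool" where
  "vector_bundle B E \<longleftrightarrow>
     continuous_map (total E) B (proj E) \<and>
     (\<forall>x\<in>topspace B. Module.module complex_ring (fibre_module E x)) \<and>
     (\<forall>x\<in>topspace B. \<exists>k. locally_trivial_at B E k x) \<and>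
     (\<forall>x\<in>topspace B. inner_product_on_fibre E x) \<and>
     continuous_map
       (subtopology (prod_topology (total E) (total E)) {(u, v). proj E u = proj E v})
       euclidean (\<lambda>(u, v). vinner E u v)"

definition has_rank :: "'b topology \<Rightarrow> ('b, 'e) vbundle \<Rightarrow> nat \<Rightarrow> bool" where
  "has_rank B E n \<longleftrightarrow> (\<forall>x\<in>topspace B. locally_trivial_at B E n x)"

text \<open>
  Isomorphisms cover the identity of the base and preserve the whole structure, including the
  inner products.
\<close>

definition bundle_isomorphic ::
    "'b topology \<Rightarrow> ('b, 'e) vbundle \<Rightarrow> ('b, 'f) vbundle \<Rightarrow> bool" where
  "bundle_isomorphic B E F \<longleftrightarrow>
     (\<exists>f. homeomorphic_map (total E) (total F) f \<and>
        (\<forall>x\<in>topspace B. \<forall>u\<in>fibre E x. proj F (f u) = x) \<and>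
        (\<forall>x\<in>topspace B. \<forall>u\<in>fibre E x. \<forall>v\<in>fibre E x. f (vadd E u v) = vadd F (f u) (f v)) \<and>
        (\<forall>x\<in>topspace B. \<forall>c. \<forall>u\<in>fibre E x. f (vscale E c u) = vscale F c (f u)) \<and>
        (\<forall>x\<in>topspace B. \<forall>u\<in>fibre E x. \<forall>v\<in>fibre E x. vinner F (f u) (f v) = vinner E u v))"

text \<open>
  The pullback of \<open>E\<close> along \<open>e: X \<rightarrow> B\<close>. For an embedding \<open>e\<close> this is the restriction \<open>E|\<^sub>X\<close>.
\<close>

definition pullback_bundle :: "'a topology \<Rightarrow> ('a \<Rightarrow> 'b) \<Rightarrow> ('b, 'e) vbundle \<Rightarrow> ('a, 'a \<times> 'e) vbundle" where
  "pullback_bundle X e E =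
     \<lparr>total = subtopology (prod_topology X (total E)) {(x, u). proj E u = e x},
      proj = fst,
      vzero = (\<lambda>x. (x, vzero E (e x))),
      vadd = (\<lambda>(x, u) (_, v). (x, vadd E u v)),
      vscale = (\<lambda>c (x, u). (x, vscale E c u)),
      vinner = (\<lambda>(_, u) (_, v). vinner E u v)\<rparr>"

end

theory Submission
  imports Defs
begin

text \<open>
  The idea is to turn the bundle into finitely many bounded functions. Suppose that there are
  finitely many continuous global sections \<open>s\<^sub>i\<close>, \<open>i < N\<close>, forming a Parseval frame of every
  fibre: \<open>\<langle>v, w\<rangle> = \<Sum>\<^sub>i \<langle>v, s\<^sub>i\<rangle> \<langle>s\<^sub>i, w\<rangle>\<close>. Then \<open>u \<mapsto> (\<langle>u, s\<^sub>i\<rangle>)\<^sub>i\<close> embeds \<open>V\<close> isometrically into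
  the trivial bundle with fibre \<open>\<complex>\<^sup>N\<close>, and its image over \<open>x\<close> is the range of the Gram matrix
  \<open>P(x)\<^sub>i\<^sub>j = \<langle>s\<^sub>j(x), s\<^sub>i(x)\<rangle>\<close>, which is an orthogonal projection of trace \<open>n\<close>. Hence \<open>V\<close> is
  recovered from the \<open>N\<^sup>2\<close> bounded continuous functions \<open>P\<^sub>i\<^sub>j\<close>.

  If these functions extend continuously to a compactification, then the extended matrices are
  again projections of trace \<open>n\<close>, because \<open>X\<close> is dense and the conditions are closed. The ranges of
  a continuous family of projections of constant trace \<open>n\<close> form a vector bundle of rank \<open>n\<close>, and
  its restriction to \<open>X\<close> is \<open>V\<close> (\<open>extension_of_bundle\<close>). All bounded continuous functions extend
  to the Stone--Cech compactification. A metrisable compactification to which the given functions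
  extend is the closure of \<open>X\<close> in \<open>\<real>\<^sup>\<nat>\<close>, where \<open>X\<close> is embedded by a sequence of functions that
  contains the real and imaginary parts of the \<open>P\<^sub>i\<^sub>j\<close>
  (\<open>metrizable_compactification_extending\<close>).

  The finite dimension of \<open>X\<close> is what makes the frame finite (\<open>finite_parseval_frame\<close>). Near
  every point the Gram--Schmidt process gives an orthonormal frame. Since \<open>X\<close> has dimension at most
  \<open>d\<close>, it is covered by \<open>d + 1\<close> open sets, each of which is a disjoint union of open sets with such
  a frame (\<open>finite_dimension_imp_finite_colouring\<close>); the frames on disjoint sets glue, and
  \<open>d + 1\<close> cut-off functions whose squares sum to \<open>1\<close> turn them into a global Parseval frame with
  \<open>(d + 1) n\<close> sections.
\<close>

section \<open>Second-countable regular spaces\<close>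

text \<open>
  Countably many Urysohn functions suffice: one for each pair of basic open sets such that the
  closure of the first is contained in the second.
\<close>

lemma second_countable_separating_sequence:
  assumes sc: "second_countable X" and nor: "normal_space X" and reg: "regular_space X"
  shows "\<exists>F::nat \<Rightarrow> 'a \<Rightarrow> real. (\<forall>k. continuous_map X (top_of_set {0..1}) (F k)) \<and>
    (\<forall>U x. openin X U \<and> x \<in> U \<longrightarrow> (\<exists>k. F k x = 1 \<and> (\<forall>y\<in>topspace X - U. F k y = 0)))"
proof -
  obtain \<B> where cB: "countable \<B>" and oB: "\<And>B. B \<in> \<B> \<Longrightarrow> openin X B"
    and bas: "\<And>U x. openin X U \<Longrightarrow> x \<in> U \<Longrightarrow> \<exists>B\<in>\<B>. x \<in> B \<and> B \<subseteq> U"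
    using sc unfolding second_countable_def by meson
  define P where "P = {(B, C). B \<in> \<B> \<and> C \<in> \<B> \<and> X closure_of B \<subseteq> C}"
  have "countable P"
    by (rule countable_subset[of _ "\<B> \<times> \<B>"]) (auto simp: P_def cB)
  have "\<exists>f. continuous_map X (top_of_set {0..1::real}) f \<and>
      (p \<in> P \<longrightarrow> (\<forall>y \<in> fst p. f y = 1) \<and> (\<forall>y \<in> topspace X - snd p. f y = 0))" for p
  proof (cases "p \<in> P")
    case True
    then obtain B C where p: "p = (B, C)" "B \<in> \<B>" "C \<in> \<B>" "X closure_of B \<subseteq> C"
      by (auto simp: P_def)
    have "closedin X (topspace X - C)" "closedin X (X closure_of B)"
      using oB[OF p(3)] by auto
    moreover have "disjnt (topspace X - C) (X closure_of B)"
      using p(4) by (auto simp: disjnt_def)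
    ultimately obtain f where f: "continuous_map X (top_of_set {0..1::real}) f"
        "f ` (topspace X - C) \<subseteq> {0}" "f ` (X closure_of B) \<subseteq> {1}"
      using Urysohn_lemma[OF nor, of "topspace X - C" "X closure_of B" 0 1] by auto
    have "B \<subseteq> X closure_of B"
      using oB[OF p(2)] by (simp add: closure_of_subset openin_subset)
    then show ?thesis
      using f p by (intro exI[of _ f]) (auto simp: image_subset_iff subset_iff)
  next
    case False
    then show ?thesis
      by (intro exI[of _ "\<lambda>_. 0"]) auto
  qed
  then obtain f where f: "\<And>p. continuous_map X (top_of_set {0..1::real}) (f p)"
    "\<And>p. p \<in> P \<Longrightarrow> (\<forall>y \<in> fst p. f p y = 1) \<and> (\<forall>y \<in> topspace X - snd p. f p y = 0)"
    by metis
  have "\<exists>k. f (from_nat_into P k) x = 1 \<and> (\<forall>y\<in>topspace X - U. f (from_nat_into P k) y = 0)"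
    if U: "openin X U" and x: "x \<in> U" for U x
  proof -
    obtain C where C: "C \<in> \<B>" "x \<in> C" "C \<subseteq> U"
      using bas[OF U x] by blast
    have "neighbourhood_base_of (closedin X) X"
      using reg by (simp add: neighbourhood_base_of_closedin)
    then obtain T D where T: "openin X T" "closedin X D" "x \<in> T" "T \<subseteq> D" "D \<subseteq> C"
      using oB[OF C(1)] C(2) unfolding neighbourhood_base_of by metis
    obtain B where B: "B \<in> \<B>" "x \<in> B" "B \<subseteq> T"
      using bas[OF T(1,3)] by blast
    have "X closure_of B \<subseteq> C"
      using B T by (meson closure_of_minimal order_trans)
    then have p: "(B, C) \<in> P"
      using B C by (auto simp: P_def)
    then obtain k where "from_nat_into P k = (B, C)"
      using \<open>countable P\<close> from_nat_into_surj by metis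
    then show ?thesis
      using f(2)[OF p] B C by (intro exI[of _ k]) auto
  qed
  then show ?thesis
    using f(1) by (intro exI[of _ "\<lambda>k. f (from_nat_into P k)"]) blast
qed

text \<open>
  The map is open onto its image because a neighbourhood of \<open>x\<close> is detected by a single coordinate:
  it contains all points where that coordinate exceeds \<open>1/2\<close>.
\<close>

lemma embedding_map_of_separating_sequence:
  fixes F :: "nat \<Rightarrow> 'a \<Rightarrow> real"
  assumes cont: "\<And>k. continuous_map X euclideanreal (F k)" and "t1_space X"
    and sep: "\<And>U x. openin X U \<Longrightarrow> x \<in> U \<Longrightarrow> \<exists>k. F k x = 1 \<and> (\<forall>y\<in>topspace X - U. F k y = 0)"
  shows "embedding_map X euclidean (\<lambda>x k. F k x)"
proof -
  define e where "e = (\<lambda>x k. F k x)"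
  have contE: "continuous_map X euclidean e"
    using cont by (simp add: e_def continuous_map_componentwise_UNIV
        flip: euclidean_product_topology)
  have "inj_on e (topspace X)"
  proof (rule inj_onI)
    fix x y assume xy: "x \<in> topspace X" "y \<in> topspace X" "e x = e y"
    show "x = y"
    proof (rule ccontr)
      assume "x \<noteq> y"
      moreover have "openin X (topspace X - {y})"
        using \<open>t1_space X\<close> xy by (simp add: t1_space_openin_delete_alt)
      ultimately obtain k where "F k x = 1" "F k y = 0"
        using sep[of "topspace X - {y}" x] xy by auto
      then show False
        using xy(3) by (auto simp: e_def fun_eq_iff)
    qed
  qed
  moreover have "open_map X (top_of_set (e ` topspace X)) e"
    unfolding open_map_def
  proof (intro allI impI)
    fix U assume U: "openin X U"
    show "openin (top_of_set (e ` topspace X)) (e ` U)"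
    proof (subst openin_subopen, intro ballI)
      fix w assume "w \<in> e ` U"
      then obtain x where x: "x \<in> U" "w = e x" by blast
      obtain k where k: "F k x = 1" "\<forall>y\<in>topspace X - U. F k y = 0"
        using sep[OF U x(1)] by blast
      have "open {v :: nat \<Rightarrow> real. 1/2 < v k}"
        by (intro open_Collect_less continuous_intros continuous_on_product_coordinates)
      then have "openin (top_of_set (e ` topspace X)) (e ` topspace X \<inter> {v. 1/2 < v k})"
        by (rule openin_open_Int)
      moreover have "e ` topspace X \<inter> {v. 1/2 < v k} \<subseteq> e ` U"
        using k by (force simp: e_def)
      moreover have "w \<in> e ` topspace X \<inter> {v. 1/2 < v k}"
        using x k openin_subset[OF U] by (auto simp: e_def)
      ultimately show "\<exists>T. openin (top_of_set (e ` topspace X)) T \<and> w \<in> T \<and> T \<subseteq> e ` U"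
        by blast
    qed
  qed
  ultimately have "homeomorphic_map X (top_of_set (e ` topspace X)) e"
    using contE by (intro bijective_open_imp_homeomorphic_map)
      (auto simp: continuous_map_in_subtopology)
  then show ?thesis
    by (simp add: embedding_map_def e_def)
qed

text \<open>
  Such an \<open>X\<close> embeds into the metric space \<open>\<real>\<^sup>\<nat>\<close>, so the distance to the complement of an open
  set is available. With the bound \<open>1\<close>, weights that tend to \<open>0\<close> make a sequence of such functions
  tend to \<open>0\<close> uniformly.
\<close>

lemma open_eq_positivity_set:
  assumes "second_countable X" "normal_space X" "regular_space X" "t1_space X" "openin X U"
  shows "\<exists>r. continuous_map X euclideanreal r \<and>
     (\<forall>x\<in>topspace X. 0 \<le> r x \<and> r x \<le> 1 \<and> (0 < r x \<longleftrightarrow> x \<in> U))"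
proof -
  obtain F :: "nat \<Rightarrow> 'a \<Rightarrow> real" where F: "\<And>k. continuous_map X (top_of_set {0..1}) (F k)"
    "\<And>U x. openin X U \<and> x \<in> U \<Longrightarrow> \<exists>k. F k x = 1 \<and> (\<forall>y\<in>topspace X - U. F k y = 0)"
    using second_countable_separating_sequence[OF assms(1-3)] by metis
  define e where "e = (\<lambda>x k. F k x)"
  have "continuous_map X euclideanreal (F k)" for k
    using F(1) by (simp add: continuous_map_in_subtopology)
  then have emb: "embedding_map X euclidean e"
    unfolding e_def using F(2) assms(4)
    by (intro embedding_map_of_separating_sequence) auto
  then have hom: "homeomorphic_map X (top_of_set (e ` topspace X)) e"
    by (simp add: embedding_map_def)
  then have "openin (top_of_set (e ` topspace X)) (e ` U)"
    using assms(5) homeomorphic_map_openness_eq by blast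
  then obtain T where T: "open T" "e ` U = e ` topspace X \<inter> T"
    by (auto simp: openin_open)
  have inj: "inj_on e (topspace X)"
    using hom homeomorphic_imp_injective_map by blast
  have mem: "e x \<in> T \<longleftrightarrow> x \<in> U" if "x \<in> topspace X" for x
    using that T(2) openin_subset[OF assms(5)] inj
    by (smt (verit) IntD2 IntI image_iff inj_on_def subsetD)
  define q where "q w = (if - T = {} then 1 else min 1 (infdist w (- T)))" for w
  have "continuous_on UNIV q"
    by (cases "- T = {}") (auto simp: q_def intro!: continuous_intros)
  then have "continuous_map euclidean euclideanreal q"
    by simp
  moreover have "continuous_map X euclidean e"
    using homeomorphic_imp_continuous_map[OF hom] by (simp add: continuous_map_in_subtopology)
  ultimately have "continuous_map X euclideanreal (q \<circ> e)"
    using continuous_map_compose by blast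
  moreover have "0 < q w \<longleftrightarrow> w \<in> T" for w
  proof (cases "- T = {}")
    case False
    have "w \<in> - T \<longleftrightarrow> infdist w (- T) = 0"
      using T(1) False by (intro in_closed_iff_infdist_zero) auto
    then show ?thesis
      using False infdist_nonneg[of w "- T"] by (auto simp: q_def)
  qed (auto simp: q_def)
  moreover have "0 \<le> q w" "q w \<le> 1" for w
    using infdist_nonneg[of w "- T"] by (auto simp: q_def)
  ultimately show ?thesis
    using mem by (intro exI[of _ "q \<circ> e"]) auto
qed

text \<open>
  Milnor's trick. Take a countable refinement \<open>\<V>\<close> of order at most \<open>d + 1\<close> and continuous functions
  \<open>l\<^sub>V\<close> with \<open>V = {l\<^sub>V > 0}\<close>. For a finite \<open>A \<subseteq> \<V>\<close> let \<open>W A\<close> be the set of points where every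
  \<open>l\<^sub>a\<close>, \<open>a \<in> A\<close>, is positive and larger than every \<open>l\<^sub>b\<close>, \<open>b \<notin> A\<close>. Two different sets \<open>A\<close> of the
  same cardinality give disjoint \<open>W A\<close>, and a point lies in \<open>W A\<close> for \<open>A\<close> the set of all members
  of \<open>\<V>\<close> that contain it. So the cardinality of \<open>A\<close> is the colour.
\<close>

lemma finite_dimension_imp_finite_colouring:
  assumes "second_countable X" "normal_space X" "regular_space X" "t1_space X"
    and dim: "covering_dim_le X d"
    and "\<And>U. U \<in> \<U> \<Longrightarrow> openin X U" "\<Union>\<U> = topspace X"
  shows "\<exists>\<W> :: nat \<Rightarrow> 'a set set.
    (\<forall>m. \<forall>W\<in>\<W> m. openin X W \<and> (\<exists>U\<in>\<U>. W \<subseteq> U)) \<and>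
    (\<forall>m. pairwise disjnt (\<W> m)) \<and>
    (\<Union>m\<in>{1..d+1}. \<Union>(\<W> m)) = topspace X"
proof -
  obtain \<V>0 where V0: "\<forall>V\<in>\<V>0. openin X V" "\<Union>\<V>0 = topspace X" "\<forall>V\<in>\<V>0. \<exists>U\<in>\<U>. V \<subseteq> U"
    "\<forall>x\<in>topspace X. finite {V\<in>\<V>0. x \<in> V} \<and> card {V\<in>\<V>0. x \<in> V} \<le> d + 1"
    using dim[unfolded covering_dim_le_def, THEN spec, of \<U>] assms(6,7) by (elim impE exE) auto
  obtain \<V> where V: "countable \<V>" "\<V> \<subseteq> \<V>0" "\<Union>\<V> = topspace X"
    using second_countable_imp_Lindelof_space[OF assms(1), unfolded Lindelof_space_def,
        THEN spec, of \<V>0] V0(1,2) by auto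
  have Vop: "openin X V" and Vref: "\<exists>U\<in>\<U>. V \<subseteq> U" if "V \<in> \<V>" for V
    using V V0 that by auto
  have ord: "finite {V\<in>\<V>. x \<in> V}" "card {V\<in>\<V>. x \<in> V} \<le> d + 1" if "x \<in> topspace X" for x
  proof -
    have "{V\<in>\<V>. x \<in> V} \<subseteq> {V\<in>\<V>0. x \<in> V}"
      using V(2) by auto
    then show "finite {V\<in>\<V>. x \<in> V}" "card {V\<in>\<V>. x \<in> V} \<le> d + 1"
      using V0(4)[rule_format, OF that] finite_subset[of "{V\<in>\<V>. x \<in> V}" "{V\<in>\<V>0. x \<in> V}"]
        card_mono[of "{V\<in>\<V>0. x \<in> V}" "{V\<in>\<V>. x \<in> V}"] by linarith+
  qed
  obtain r where r: "\<And>V. V \<in> \<V> \<Longrightarrow> continuous_map X euclideanreal (r V)"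
    "\<And>V x. V \<in> \<V> \<Longrightarrow> x \<in> topspace X \<Longrightarrow> 0 \<le> r V x \<and> r V x \<le> 1 \<and> (0 < r V x \<longleftrightarrow> x \<in> V)"
    using open_eq_positivity_set[OF assms(1-4) Vop] by metis
  \<comment> \<open>The cover need not be locally finite. The weights make all but finitely many \<open>l\<^sub>V\<close> smaller
    than any given positive number, which is what the openness of \<open>T a A\<close> requires.\<close>
  define l where "l V x = (1/2) ^ (to_nat_on \<V> V) * r V x" for V x
  have lcont: "continuous_map X euclideanreal (l V)" if "V \<in> \<V>" for V
    unfolding l_def using r(1)[OF that] by (intro continuous_intros) auto
  have lpos: "0 < l V x \<longleftrightarrow> x \<in> V" and lle: "l V x \<le> (1/2) ^ (to_nat_on \<V> V)"
    if "V \<in> \<V>" "x \<in> topspace X" for V x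
    using r(2)[OF that] by (auto simp: l_def zero_less_mult_iff mult_le_cancel_left1)
  have fin: "finite {V\<in>\<V>. \<epsilon> \<le> (1/2) ^ (to_nat_on \<V> V)}" if pos: "0 < \<epsilon>" for \<epsilon> :: real
  proof -
    obtain N where N: "(1/2) ^ N < \<epsilon>"
      using real_arch_pow_inv[OF pos, of "1/2"] by auto
    have "to_nat_on \<V> ` {V\<in>\<V>. \<epsilon> \<le> (1/2) ^ (to_nat_on \<V> V)} \<subseteq> {..<N}"
    proof clarsimp
      fix V assume "\<epsilon> \<le> (1/2) ^ (to_nat_on \<V> V)"
      with N have "(1/2::real) ^ N < (1/2) ^ (to_nat_on \<V> V)" by linarith
      then show "to_nat_on \<V> V < N"
        by (simp add: power_strict_decreasing_iff)
    qed
    then have "finite (to_nat_on \<V> ` {V\<in>\<V>. \<epsilon> \<le> (1/2) ^ (to_nat_on \<V> V)})"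
      using finite_subset by blast
    moreover have "inj_on (to_nat_on \<V>) {V\<in>\<V>. \<epsilon> \<le> (1/2) ^ (to_nat_on \<V> V)}"
      using inj_on_to_nat_on[OF V(1)] by (rule inj_on_subset) auto
    ultimately show ?thesis
      using finite_imageD by blast
  qed
  define T where "T a A = {x\<in>topspace X. 0 < l a x \<and> (\<forall>b\<in>\<V> - A. l b x < l a x)}" for a A
  have Top: "openin X (T a A)" if a: "a \<in> \<V>" for a A
  proof (subst openin_subopen, intro ballI)
    fix x assume x: "x \<in> T a A"
    define \<epsilon> where "\<epsilon> = l a x / 2"
    define B where "B = {b\<in>\<V> - A. \<epsilon> \<le> (1/2) ^ (to_nat_on \<V> b)}"
    have e: "0 < \<epsilon>" using x by (auto simp: \<epsilon>_def T_def)
    have B: "finite B"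
      by (rule finite_subset[OF _ fin[OF e]]) (auto simp: B_def)
    define S where "S = {y\<in>topspace X. \<epsilon> < l a y} \<inter> (\<Inter>b\<in>B. {y\<in>topspace X. l b y < l a y})"
    have half: "openin X {y\<in>topspace X. f y < g y}"
      if "continuous_map X euclideanreal f" "continuous_map X euclideanreal g" for f g
    proof -
      have "openin X {y\<in>topspace X. g y - f y \<in> {0<..}}"
        using that by (intro openin_continuous_map_preimage[of _ euclideanreal] continuous_intros) auto
      then show ?thesis by simp
    qed
    have "openin X S"
    proof (cases "B = {}")
      case True
      then show ?thesis
        unfolding S_def using half[of "\<lambda>_. \<epsilon>" "l a"] lcont[OF a] by simp
    next
      case False
      then show ?thesis
        unfolding S_def using half[of "\<lambda>_. \<epsilon>" "l a"] half[of "l _" "l a"] lcont a B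
        by (intro openin_Int openin_INT2) (auto simp: B_def)
    qed
    moreover have "x \<in> S"
      using x by (auto simp: S_def T_def \<epsilon>_def B_def)
    moreover have "S \<subseteq> T a A"
    proof
      fix y assume y: "y \<in> S"
      have "l b y < l a y" if b: "b \<in> \<V> - A" for b
      proof (cases "b \<in> B")
        case False
        then have "l b y < \<epsilon>"
          using b lle[of b y] y by (auto simp: B_def S_def)
        then show ?thesis using y by (auto simp: S_def)
      qed (use y in \<open>auto simp: S_def\<close>)
      then show "y \<in> T a A"
        using y e by (auto simp: S_def T_def)
    qed
    ultimately show "\<exists>S. openin X S \<and> x \<in> S \<and> S \<subseteq> T a A" by blast
  qed
  define W where "W A = (\<Inter>a\<in>A. T a A)" for A
  define \<W> where "\<W> m = {W A | A. A \<subseteq> \<V> \<and> A \<noteq> {} \<and> finite A \<and> card A = m}" for m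
  have "openin X Z \<and> (\<exists>U\<in>\<U>. Z \<subseteq> U)" if Z: "Z \<in> \<W> m" for Z m
  proof -
    obtain A where A: "Z = W A" "A \<subseteq> \<V>" "A \<noteq> {}" "finite A"
      using Z by (auto simp: \<W>_def)
    have "openin X Z"
      unfolding A(1) W_def using A Top by (intro openin_INT2) auto
    moreover obtain a where a: "a \<in> A" using A(3) by blast
    have "Z \<subseteq> a"
      using A a lpos by (auto simp: W_def T_def)
    ultimately show ?thesis
      using Vref[of a] a A by (meson order_trans subsetD)
  qed
  moreover have "pairwise disjnt (\<W> m)" for m
  proof (clarsimp simp: pairwise_def)
    fix Z Z' assume "Z \<in> \<W> m" "Z' \<in> \<W> m" "Z \<noteq> Z'"
    then obtain A A' where A: "Z = W A" "A \<subseteq> \<V>" "finite A" "card A = m"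
      and A': "Z' = W A'" "A' \<subseteq> \<V>" "finite A'" "card A' = m" and ne: "A \<noteq> A'"
      by (auto simp: \<W>_def)
    obtain a where a: "a \<in> A" "a \<notin> A'"
      using A A' ne by (metis card_subset_eq subsetI)
    obtain a' where a': "a' \<in> A'" "a' \<notin> A"
      using A A' ne by (metis card_subset_eq subsetI)
    show "disjnt Z Z'"
      unfolding disjnt_iff
    proof (intro allI notI, elim conjE)
      fix x assume "x \<in> Z" "x \<in> Z'"
      then have "x \<in> T a A" "x \<in> T a' A'"
        using a a' A(1) A'(1) by (auto simp: W_def)
      then have "l a' x < l a x" "l a x < l a' x"
        using a a' A(2) A'(2) by (auto simp: T_def)
      then show False by simp
    qed
  qed
  moreover have "(\<Union>m\<in>{1..d+1}. \<Union>(\<W> m)) = topspace X"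
  proof
    show "(\<Union>m\<in>{1..d+1}. \<Union>(\<W> m)) \<subseteq> topspace X"
      using calculation(1) openin_subset by blast
    show "topspace X \<subseteq> (\<Union>m\<in>{1..d+1}. \<Union>(\<W> m))"
    proof
      fix x assume x: "x \<in> topspace X"
      define A where "A = {V\<in>\<V>. x \<in> V}"
      have A: "finite A" "card A \<le> d + 1" "A \<noteq> {}" "A \<subseteq> \<V>"
        using ord[OF x] V(3) x by (auto simp: A_def)
      have "l b x < l a x" if "a \<in> A" "b \<in> \<V> - A" for a b
        using lpos[OF _ x, of a] lpos[OF _ x, of b] that by (auto simp: A_def)
      then have "x \<in> W A"
        using x lpos[OF _ x] A(4) by (auto simp: W_def T_def A_def)
      moreover have "W A \<in> \<W> (card A)" "card A \<in> {1..d+1}"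
        using A by (auto simp: \<W>_def Suc_le_eq card_gt_0_iff)
      ultimately show "x \<in> (\<Union>m\<in>{1..d+1}. \<Union>(\<W> m))" by blast
    qed
  qed
  ultimately show ?thesis
    by (intro exI[of _ \<W>]) blast
qed

section \<open>Algebra and continuity in a Hermitian bundle\<close>

lemma continuous_map_mult_algebra [continuous_intros]:
  fixes f g :: "'a \<Rightarrow> 'b::real_normed_algebra"
  shows "\<lbrakk>continuous_map X euclidean f; continuous_map X euclidean g\<rbrakk>
    \<Longrightarrow> continuous_map X euclidean (\<lambda>x. f x * g x)"
  by (simp add: continuous_map_atin tendsto_mult)

lemma continuous_map_cnj [continuous_intros]:
  "continuous_map X euclidean f \<Longrightarrow> continuous_map X euclidean (\<lambda>x. cnj (f x))"
  by (simp add: continuous_map_atin tendsto_cnj)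

lemma continuous_map_Re [continuous_intros]:
  "continuous_map X euclidean f \<Longrightarrow> continuous_map X euclideanreal (\<lambda>x. Re (f x))"
  by (simp add: continuous_map_atin tendsto_Re)

lemma continuous_map_Im [continuous_intros]:
  "continuous_map X euclidean f \<Longrightarrow> continuous_map X euclideanreal (\<lambda>x. Im (f x))"
  by (simp add: continuous_map_atin tendsto_Im)

lemma continuous_map_of_real [continuous_intros]:
  "continuous_map X euclideanreal f
    \<Longrightarrow> continuous_map X euclidean (\<lambda>x. of_real (f x) :: 'b::real_normed_algebra_1)"
  by (simp add: continuous_map_atin tendsto_of_real)

lemma continuous_map_inverse_sqrt [continuous_intros]:
  "\<lbrakk>continuous_map X euclideanreal f; \<And>x. x \<in> topspace X \<Longrightarrow> 0 < f x\<rbrakk>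
    \<Longrightarrow> continuous_map X euclideanreal (\<lambda>x. inverse (sqrt (f x)))"
  by (fastforce simp: continuous_map_atin intro!: tendsto_inverse tendsto_real_sqrt)

text \<open>
  By recursion on the number of terms, inner products and continuity of linear combinations reduce to
  those of a single sum and a single multiple.
\<close>

primrec fibre_sum :: "('b, 'e) vbundle \<Rightarrow> 'b \<Rightarrow> (nat \<Rightarrow> complex) \<Rightarrow> (nat \<Rightarrow> 'e) \<Rightarrow> nat \<Rightarrow> 'e" where
  "fibre_sum E x c s 0 = vzero E x"
| "fibre_sum E x c s (Suc k) = vadd E (fibre_sum E x c s k) (vscale E (c k) (s k))"

locale hermitian_bundle =
  fixes B :: "'b topology" and E :: "('b, 'e) vbundle"
  assumes vbundle: "vector_bundle B E"
begin

lemma proj_continuous: "continuous_map (total E) B (proj E)"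
  using vbundle by (simp add: vector_bundle_def)

lemma in_fibre:
  "u \<in> topspace (total E) \<Longrightarrow> proj E u \<in> topspace B"
  "u \<in> fibre E x \<Longrightarrow> x \<in> topspace B"
  "u \<in> fibre E x \<Longrightarrow> u \<in> topspace (total E)"
  "u \<in> fibre E x \<Longrightarrow> proj E u = x"
  "u \<in> topspace (total E) \<Longrightarrow> u \<in> fibre E (proj E u)"
  using continuous_map_image_subset_topspace[OF proj_continuous] by (auto simp: fibre_def)

lemma fibre_module: "x \<in> topspace B \<Longrightarrow> Module.module complex_ring (fibre_module E x)"
  using vbundle by (simp add: vector_bundle_def)

lemma zero_in_fibre: "x \<in> topspace B \<Longrightarrow> vzero E x \<in> fibre E x"
  using fibre_module[of x] unfolding fibre_module_def
  by (metis (no_types, lifting) Module.module.axioms(2) abelian_group.axioms(1) abelian_monoid.zero_closed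
      partial_object.select_convs(1) ring.simps(1))

lemma add_in_fibre:
  assumes "u \<in> fibre E x" "v \<in> fibre E x" shows "vadd E u v \<in> fibre E x"
proof -
  interpret M: Module.module complex_ring "fibre_module E x"
    using fibre_module in_fibre(2) assms by blast
  show ?thesis using M.M.a_closed[of u v] assms by (simp add: fibre_module_def)
qed

lemma scale_in_fibre:
  assumes "u \<in> fibre E x" shows "vscale E c u \<in> fibre E x"
proof -
  interpret M: Module.module complex_ring "fibre_module E x"
    using fibre_module in_fibre(2) assms by blast
  show ?thesis using M.smult_closed[of c u] assms by (simp add: fibre_module_def complex_ring_def)
qed

lemma vadd_zero:
  assumes "u \<in> fibre E x" shows "vadd E (vzero E x) u = u"
proof -
  interpret M: Module.module complex_ring "fibre_module E x"
    using fibre_module in_fibre(2) assms by blast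
  show ?thesis using M.M.l_zero[of u] assms by (simp add: fibre_module_def)
qed

lemma eq_if_difference_zero:
  assumes u: "u \<in> fibre E x" and v: "v \<in> fibre E x" and z: "vadd E u (vscale E (- 1) v) = vzero E x"
  shows "u = v"
proof -
  interpret M: Module.module complex_ring "fibre_module E x"
    using fibre_module in_fibre(2) u by blast
  have "(\<one>\<^bsub>complex_ring\<^esub> \<oplus>\<^bsub>complex_ring\<^esub> (- 1)) \<odot>\<^bsub>fibre_module E x\<^esub> v = \<zero>\<^bsub>fibre_module E x\<^esub>"
    using M.smult_l_null[of v] v by (simp add: fibre_module_def complex_ring_def)
  then have w: "vadd E v (vscale E (- 1) v) = vzero E x"
    using M.smult_l_distr[of 1 "-1" v] M.smult_one[of v] v
    by (simp add: fibre_module_def complex_ring_def)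
  have "v \<oplus>\<^bsub>fibre_module E x\<^esub> vscale E (- 1) v = u \<oplus>\<^bsub>fibre_module E x\<^esub> vscale E (- 1) v"
    using w z by (simp add: fibre_module_def)
  then show ?thesis
    using M.M.add.right_cancel[of "vscale E (- 1) v" v u] u v scale_in_fibre[OF v, of "-1"]
    by (simp add: fibre_module_def)
qed

lemma inner_product: "x \<in> topspace B \<Longrightarrow> inner_product_on_fibre E x"
  using vbundle by (simp add: vector_bundle_def)

lemma inner_add_left:
  "\<lbrakk>u \<in> fibre E x; v \<in> fibre E x; w \<in> fibre E x\<rbrakk>
    \<Longrightarrow> vinner E (vadd E u v) w = vinner E u w + vinner E v w"
  using inner_product[OF in_fibre(2), unfolded inner_product_on_fibre_def, THEN conjunct1] by blast

lemma inner_scale_left: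
  "\<lbrakk>u \<in> fibre E x; v \<in> fibre E x\<rbrakk> \<Longrightarrow> vinner E (vscale E c u) v = c * vinner E u v"
  using inner_product[OF in_fibre(2), unfolded inner_product_on_fibre_def,
      THEN conjunct2, THEN conjunct1] by blast

lemma inner_commute:
  "\<lbrakk>u \<in> fibre E x; v \<in> fibre E x\<rbrakk> \<Longrightarrow> vinner E v u = cnj (vinner E u v)"
  using inner_product[OF in_fibre(2), unfolded inner_product_on_fibre_def,
      THEN conjunct2, THEN conjunct2, THEN conjunct1] by blast

lemma inner_pos:
  "\<lbrakk>u \<in> fibre E x; u \<noteq> vzero E x\<rbrakk> \<Longrightarrow> 0 < Re (vinner E u u)"
  using inner_product[OF in_fibre(2), unfolded inner_product_on_fibre_def,
      THEN conjunct2, THEN conjunct2, THEN conjunct2] by blast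

lemma inner_scale_right:
  "\<lbrakk>u \<in> fibre E x; v \<in> fibre E x\<rbrakk> \<Longrightarrow> vinner E u (vscale E c v) = cnj c * vinner E u v"
  using inner_commute[of "vscale E c v" x u] inner_commute[of v x u]
    inner_scale_left[of v x u c] scale_in_fibre[of v x c] by simp

lemma inner_zero_left: "u \<in> fibre E x \<Longrightarrow> vinner E (vzero E x) u = 0"
  using inner_add_left[of "vzero E x" x "vzero E x" u] vadd_zero[of "vzero E x" x]
    zero_in_fibre[of x] in_fibre(2)[of u x] by simp

lemma inner_zero_right: "u \<in> fibre E x \<Longrightarrow> vinner E u (vzero E x) = 0"
  using inner_commute[of "vzero E x" x u] inner_zero_left[of u x] zero_in_fibre[of x]
    in_fibre(2)[of u x] by simp

lemma inner_self_real: "u \<in> fibre E x \<Longrightarrow> vinner E u u = of_real (Re (vinner E u u))"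
  using inner_commute[of u x u] by (simp add: complex_eq_iff)

text \<open>
  Non-degeneracy of the inner product. It reduces identities between vectors of a fibre to
  identities between complex numbers.
\<close>

lemma fibre_eqI:
  assumes u: "u \<in> fibre E x" and v: "v \<in> fibre E x"
    and eq: "\<And>w. w \<in> fibre E x \<Longrightarrow> vinner E u w = vinner E v w"
  shows "u = v"
proof (rule eq_if_difference_zero[OF u v], rule ccontr)
  define d where "d = vadd E u (vscale E (- 1) v)"
  assume "vadd E u (vscale E (- 1) v) \<noteq> vzero E x"
  moreover have d: "d \<in> fibre E x"
    unfolding d_def by (intro add_in_fibre scale_in_fibre u v)
  ultimately have "0 < Re (vinner E d d)"
    using inner_pos by (simp add: d_def)
  moreover have "vinner E d d = vinner E u d - vinner E v d"
    by (subst d_def) (simp add: inner_add_left[OF u scale_in_fibre[OF v] d] inner_scale_left[OF v d])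
  ultimately show False
    using eq[OF d] by simp
qed

lemma fibre_sum_in_fibre:
  "\<lbrakk>x \<in> topspace B; \<And>i. i < k \<Longrightarrow> s i \<in> fibre E x\<rbrakk> \<Longrightarrow> fibre_sum E x c s k \<in> fibre E x"
  by (induction k) (auto intro: zero_in_fibre add_in_fibre scale_in_fibre)

lemma inner_fibre_sum_left:
  "\<lbrakk>w \<in> fibre E x; \<And>i. i < k \<Longrightarrow> s i \<in> fibre E x\<rbrakk>
    \<Longrightarrow> vinner E (fibre_sum E x c s k) w = (\<Sum>i<k. c i * vinner E (s i) w)"
  by (induction k) (auto simp: inner_zero_left inner_add_left[where x = x] inner_scale_left[where x = x]
      scale_in_fibre fibre_sum_in_fibre in_fibre(2))

lemma inner_continuous:
  assumes \<sigma>: "continuous_map T (total E) \<sigma>" and \<tau>: "continuous_map T (total E) \<tau>"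
    and eq: "\<And>t. t \<in> topspace T \<Longrightarrow> proj E (\<sigma> t) = proj E (\<tau> t)"
  shows "continuous_map T euclidean (\<lambda>t. vinner E (\<sigma> t) (\<tau> t))"
proof -
  have "continuous_map T (subtopology (prod_topology (total E) (total E))
      {(u, v). proj E u = proj E v}) (\<lambda>t. (\<sigma> t, \<tau> t))"
    using \<sigma> \<tau> eq by (auto simp: continuous_map_in_subtopology continuous_map_paired)
  moreover have "continuous_map (subtopology (prod_topology (total E) (total E))
      {(u, v). proj E u = proj E v}) euclidean (\<lambda>(u, v). vinner E u v)"
    using vbundle by (simp add: vector_bundle_def)
  ultimately show ?thesis
    using continuous_map_compose by (fastforce simp: o_def)
qed

end

locale trivialized_bundle = hermitian_bundle +
  fixes U and k and \<phi>
  assumes openU: "openin B U" and triv: "local_trivialization B E U k \<phi>"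
begin

definition "coord u i = snd (\<phi> u) i"

lemma \<phi>_homeo: "homeomorphic_map (subtopology (total E) {u. proj E u \<in> U})
       (prod_topology (subtopology B U) (complex_space k)) \<phi>"
  using triv by (simp add: local_trivialization_def)

lemma coord_add:
  "\<lbrakk>x \<in> U; u \<in> fibre E x; v \<in> fibre E x; i < k\<rbrakk> \<Longrightarrow> coord (vadd E u v) i = coord u i + coord v i"
  using triv unfolding local_trivialization_def coord_def by blast

lemma coord_scale:
  "\<lbrakk>x \<in> U; u \<in> fibre E x; i < k\<rbrakk> \<Longrightarrow> coord (vscale E c u) i = c * coord u i"
  using triv unfolding local_trivialization_def coord_def by blast

lemma fst_\<phi>: "\<lbrakk>x \<in> U; u \<in> fibre E x\<rbrakk> \<Longrightarrow> fst (\<phi> u) = x"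
  using triv unfolding local_trivialization_def by blast

lemma U_subset: "U \<subseteq> topspace B"
  using openU openin_subset by blast

lemma coord_zero: "\<lbrakk>x \<in> U; i < k\<rbrakk> \<Longrightarrow> coord (vzero E x) i = 0"
  using coord_add[of x "vzero E x" "vzero E x" i] vadd_zero[of "vzero E x" x] zero_in_fibre[of x] U_subset
  by (metis add_cancel_right_right subsetD)

lemma \<phi>_in: "u \<in> topspace (total E) \<Longrightarrow> proj E u \<in> U \<Longrightarrow> \<phi> u \<in> U \<times> extensional {..<k}"
  using continuous_map_image_subset_topspace[OF homeomorphic_imp_continuous_map[OF \<phi>_homeo]]
  by (auto simp: complex_space_def PiE_def)

lemma fibre_eq_coordI:
  assumes x: "x \<in> U" and u: "u \<in> fibre E x" and v: "v \<in> fibre E x"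
    and eq: "\<And>i. i < k \<Longrightarrow> coord u i = coord v i"
  shows "u = v"
proof -
  have "\<phi> u \<in> U \<times> extensional {..<k}" "\<phi> v \<in> U \<times> extensional {..<k}"
    using \<phi>_in in_fibre u v x by metis+
  then have "snd (\<phi> u) = snd (\<phi> v)"
    using eq by (intro extensionalityI[of _ "{..<k}"]) (auto simp: coord_def)
  moreover have "fst (\<phi> u) = fst (\<phi> v)"
    using fst_\<phi> u v x by metis
  ultimately have "\<phi> u = \<phi> v"
    by (rule prod_eqI[rotated])
  then show ?thesis
    using homeomorphic_imp_injective_map[OF \<phi>_homeo] u v x
    by (auto simp: inj_on_def fibre_def)
qed

lemma coord_continuous:
  assumes \<sigma>: "continuous_map T (total E) \<sigma>" and U: "\<And>t. t \<in> topspace T \<Longrightarrow> proj E (\<sigma> t) \<in> U" and i: "i < k"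
  shows "continuous_map T euclidean (\<lambda>t. coord (\<sigma> t) i)"
proof -
  have "continuous_map T (subtopology (total E) {u. proj E u \<in> U}) \<sigma>"
    using \<sigma> U by (auto simp: continuous_map_in_subtopology)
  then have "continuous_map T (prod_topology (subtopology B U) (complex_space k)) (\<phi> \<circ> \<sigma>)"
    using homeomorphic_imp_continuous_map[OF \<phi>_homeo] continuous_map_compose by blast
  then have "continuous_map T (complex_space k) (\<lambda>t. snd (\<phi> (\<sigma> t)))"
    by (simp add: continuous_map_pairwise o_def)
  then show ?thesis
    using i by (simp add: complex_space_def continuous_map_componentwise coord_def)
qed

lemma continuous_of_coord:
  assumes g: "continuous_map T B g" and U: "\<And>t. t \<in> topspace T \<Longrightarrow> g t \<in> U"
    and fib: "\<And>t. t \<in> topspace T \<Longrightarrow> \<sigma> t \<in> fibre E (g t)"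
    and co: "\<And>i. i < k \<Longrightarrow> continuous_map T euclidean (\<lambda>t. coord (\<sigma> t) i)"
  shows "continuous_map T (total E) \<sigma>"
proof -
  have top: "\<sigma> t \<in> topspace (total E)" "proj E (\<sigma> t) = g t" if "t \<in> topspace T" for t
    using fib[OF that] by (auto simp: fibre_def)
  obtain \<psi> where \<psi>: "homeomorphic_maps (subtopology (total E) {u. proj E u \<in> U})
       (prod_topology (subtopology B U) (complex_space k)) \<phi> \<psi>"
    using \<phi>_homeo homeomorphic_map_maps by blast
  have "continuous_map T (subtopology B U) (\<lambda>t. fst (\<phi> (\<sigma> t)))"
  proof (rule continuous_map_eq[of _ _ g])
    show "continuous_map T (subtopology B U) g"
      using g U by (auto simp: continuous_map_in_subtopology)
  qed (use fst_\<phi> U fib in metis)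
  moreover have "continuous_map T (complex_space k) (\<lambda>t. snd (\<phi> (\<sigma> t)))"
    unfolding complex_space_def continuous_map_componentwise
    using co \<phi>_in top U by (auto simp: coord_def mem_Times_iff image_subset_iff)
  ultimately have "continuous_map T (prod_topology (subtopology B U) (complex_space k)) (\<lambda>t. \<phi> (\<sigma> t))"
    by (simp add: continuous_map_pairwise o_def)
  moreover have "continuous_map (prod_topology (subtopology B U) (complex_space k)) (total E) \<psi>"
    using \<psi> by (auto simp: homeomorphic_maps_def continuous_map_in_subtopology)
  ultimately have "continuous_map T (total E) (\<lambda>t. \<psi> (\<phi> (\<sigma> t)))"
    using continuous_map_compose by (fastforce simp: o_def)
  then show ?thesis
    by (rule continuous_map_eq) (use \<psi> top U in \<open>auto simp: homeomorphic_maps_def\<close>)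
qed

lemma ex_coord:
  assumes x: "x \<in> U" and c: "c \<in> extensional {..<k}"
  shows "\<exists>u\<in>fibre E x. \<forall>i<k. coord u i = c i"
proof -
  have "(x, c) \<in> topspace (prod_topology (subtopology B U) (complex_space k))"
    using x c U_subset by (auto simp: complex_space_def PiE_def)
  then obtain u where u: "u \<in> topspace (total E)" "proj E u \<in> U" "\<phi> u = (x, c)"
    unfolding homeomorphic_imp_surjective_map[OF \<phi>_homeo, symmetric] by auto
  then have "u \<in> fibre E x"
    using fst_\<phi>[of "proj E u" u] in_fibre(5)[of u] by auto
  then show ?thesis
    using u(3) by (intro bexI[of _ u]) (simp_all add: coord_def)
qed

end

context hermitian_bundle begin

lemma locally_trivial:
  "x \<in> topspace B \<Longrightarrow> \<exists>U k \<phi>. x \<in> U \<and> trivialized_bundle B E U k \<phi>"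
  using vbundle hermitian_bundle_axioms
  unfolding vector_bundle_def locally_trivial_at_def trivialized_bundle_def trivialized_bundle_axioms_def
  by blast

text \<open>
  Reading vectors in local coordinates reduces the continuity of the fibrewise operations to that of
  the addition and multiplication of complex numbers. Allowing an arbitrary space \<open>T\<close> over the base
  covers sections over open sets, the total space itself and pullbacks at once.
\<close>

lemma continuous_into_bundleI:
  assumes g: "continuous_map T B g" and fib: "\<And>t. t \<in> topspace T \<Longrightarrow> \<sigma> t \<in> fibre E (g t)"
    and co: "\<And>U k \<phi> S i. \<lbrakk>trivialized_bundle B E U k \<phi>; S = subtopology T {t. g t \<in> U}; i < k\<rbrakk>
      \<Longrightarrow> continuous_map S euclidean (\<lambda>t. trivialized_bundle.coord \<phi> (\<sigma> t) i)"
  shows "continuous_map T (total E) \<sigma>"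
proof -
  have "\<forall>t\<in>topspace T. \<exists>U k \<phi>. g t \<in> U \<and> trivialized_bundle B E U k \<phi>"
    using locally_trivial g by (meson continuous_map_image_subset_topspace image_subset_iff)
  then obtain U k \<phi> where U: "\<And>t. t \<in> topspace T \<Longrightarrow> g t \<in> U t"
    "\<And>t. t \<in> topspace T \<Longrightarrow> trivialized_bundle B E (U t) (k t) (\<phi> t)"
    by metis
  define S where "S t = {s \<in> topspace T. g s \<in> U t}" for t
  show ?thesis
  proof (rule pasting_lemma[of "topspace T" T S _ "\<lambda>_. \<sigma>"])
    fix t assume t: "t \<in> topspace T"
    interpret trivialized_bundle B E "U t" "k t" "\<phi> t" using U(2)[OF t] .
    show "openin T (S t)"
      unfolding S_def using g openU openin_continuous_map_preimage by blast
    have eq: "subtopology T (S t) = subtopology T {s. g s \<in> U t}"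
      using subtopology_restrict[of T "{s. g s \<in> U t}"] by (simp add: S_def Int_def)
    show "continuous_map (subtopology T (S t)) (total E) \<sigma>"
    proof (rule continuous_of_coord)
      show "continuous_map (subtopology T (S t)) B g"
        using g by (rule continuous_map_from_subtopology)
      show "continuous_map (subtopology T (S t)) euclidean (\<lambda>s. coord (\<sigma> s) i)" if "i < k t" for i
        using co[OF U(2)[OF t] eq that] by (simp add: eq)
    qed (use fib in \<open>auto simp: S_def\<close>)
  qed (use U(1) in \<open>auto simp: S_def\<close>)
qed

lemma vadd_continuous:
  assumes \<sigma>: "continuous_map T (total E) \<sigma>" and \<tau>: "continuous_map T (total E) \<tau>"
    and eq: "\<And>t. t \<in> topspace T \<Longrightarrow> proj E (\<sigma> t) = proj E (\<tau> t)"
  shows "continuous_map T (total E) (\<lambda>t. vadd E (\<sigma> t) (\<tau> t))"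
proof (rule continuous_into_bundleI[of _ "\<lambda>t. proj E (\<sigma> t)"])
  show "continuous_map T B (\<lambda>t. proj E (\<sigma> t))"
    using continuous_map_compose[OF \<sigma> proj_continuous] by (simp add: o_def)
  have fib: "\<sigma> t \<in> fibre E (proj E (\<sigma> t))" "\<tau> t \<in> fibre E (proj E (\<sigma> t))" if "t \<in> topspace T" for t
    using \<sigma> \<tau> eq that continuous_map_image_subset_topspace in_fibre(5) by (metis image_subset_iff)+
  then show "vadd E (\<sigma> t) (\<tau> t) \<in> fibre E (proj E (\<sigma> t))" if "t \<in> topspace T" for t
    using add_in_fibre that by blast
  fix U k \<phi> S and i :: nat
  assume t: "trivialized_bundle B E U k \<phi>" and S: "S = subtopology T {t. proj E (\<sigma> t) \<in> U}" and i: "i < k"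
  interpret trivialized_bundle B E U k \<phi> by fact
  have "continuous_map S euclidean (\<lambda>t. coord (\<sigma> t) i + coord (\<tau> t) i)"
    using \<sigma> \<tau> eq i by (intro continuous_map_add coord_continuous)
      (auto simp: S intro: continuous_map_from_subtopology)
  then show "continuous_map S euclidean (\<lambda>t. coord (vadd E (\<sigma> t) (\<tau> t)) i)"
    by (rule continuous_map_eq) (use fib coord_add i in \<open>auto simp: S\<close>)
qed

lemma vscale_continuous:
  assumes \<sigma>: "continuous_map T (total E) \<sigma>" and c: "continuous_map T euclidean c"
  shows "continuous_map T (total E) (\<lambda>t. vscale E (c t) (\<sigma> t))"
proof (rule continuous_into_bundleI[of _ "\<lambda>t. proj E (\<sigma> t)"])
  show "continuous_map T B (\<lambda>t. proj E (\<sigma> t))"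
    using continuous_map_compose[OF \<sigma> proj_continuous] by (simp add: o_def)
  have fib: "\<sigma> t \<in> fibre E (proj E (\<sigma> t))" if "t \<in> topspace T" for t
    using \<sigma> that continuous_map_image_subset_topspace in_fibre(5) by (metis image_subset_iff)+
  then show "vscale E (c t) (\<sigma> t) \<in> fibre E (proj E (\<sigma> t))" if "t \<in> topspace T" for t
    using scale_in_fibre that by blast
  fix U k \<phi> S and i :: nat
  assume t: "trivialized_bundle B E U k \<phi>" and S: "S = subtopology T {t. proj E (\<sigma> t) \<in> U}" and i: "i < k"
  interpret trivialized_bundle B E U k \<phi> by fact
  have "continuous_map S euclidean (\<lambda>t. c t * coord (\<sigma> t) i)"
    using \<sigma> c i by (intro continuous_map_mult_algebra coord_continuous)
      (auto simp: S intro: continuous_map_from_subtopology)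
  then show "continuous_map S euclidean (\<lambda>t. coord (vscale E (c t) (\<sigma> t)) i)"
    by (rule continuous_map_eq) (use fib coord_scale i in \<open>auto simp: S\<close>)
qed

lemma vzero_continuous:
  assumes g: "continuous_map T B g"
  shows "continuous_map T (total E) (\<lambda>t. vzero E (g t))"
proof (rule continuous_into_bundleI[OF g])
  show "vzero E (g t) \<in> fibre E (g t)" if "t \<in> topspace T" for t
    using that g zero_in_fibre by (meson continuous_map_image_subset_topspace image_subset_iff)
  fix U k \<phi> S and i :: nat
  assume t: "trivialized_bundle B E U k \<phi>" and S: "S = subtopology T {t. g t \<in> U}" and i: "i < k"
  interpret trivialized_bundle B E U k \<phi> by fact
  have "continuous_map S euclidean (\<lambda>t. 0::complex)"
    by simp
  then show "continuous_map S euclidean (\<lambda>t. coord (vzero E (g t)) i)"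
    by (rule continuous_map_eq) (use i in \<open>auto simp: S coord_zero\<close>)
qed

lemma fibre_sum_continuous:
  assumes g: "continuous_map T B g"
    and "\<And>i. i < k \<Longrightarrow> continuous_map T euclidean (\<lambda>t. c t i)"
    and "\<And>i. i < k \<Longrightarrow> continuous_map T (total E) (\<lambda>t. s t i)"
    and "\<And>t i. \<lbrakk>t \<in> topspace T; i < k\<rbrakk> \<Longrightarrow> s t i \<in> fibre E (g t)"
  shows "continuous_map T (total E) (\<lambda>t. fibre_sum E (g t) (c t) (s t) k)"
  using assms(2-)
proof (induction k)
  case 0
  then show ?case using vzero_continuous[OF g] by simp
next
  case (Suc k)
  have "proj E (fibre_sum E (g t) (c t) (s t) k) = proj E (vscale E (c t k) (s t k))"
    if t: "t \<in> topspace T" for t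
  proof -
    have "g t \<in> topspace B" using g t continuous_map_image_subset_topspace by fastforce
    then have "fibre_sum E (g t) (c t) (s t) k \<in> fibre E (g t)" "vscale E (c t k) (s t k) \<in> fibre E (g t)"
      using Suc.prems(3) t by (auto intro!: fibre_sum_in_fibre scale_in_fibre)
    then show ?thesis using in_fibre(4) by metis
  qed
  then show ?case
    using Suc by (auto intro!: vadd_continuous vscale_continuous)
qed

end

section \<open>Parseval frames\<close>

context hermitian_bundle begin

lemma scale_zero: "u \<in> fibre E x \<Longrightarrow> vscale E 0 u = vzero E x"
  by (rule fibre_eqI[where x = x])
    (auto simp: inner_scale_left[where x = x] inner_zero_left scale_in_fibre zero_in_fibre in_fibre(2))

text \<open>
  Equivalently, \<open>v = \<Sum>\<^sub>i \<langle>v, s\<^sub>i\<rangle> s\<^sub>i\<close> for all \<open>v\<close>. In contrast to an orthonormal frame, the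
  sections may vanish or be linearly dependent, so a global such family can exist on a non-trivial
  bundle.
\<close>

definition parseval_frame :: "'b set \<Rightarrow> nat \<Rightarrow> (nat \<Rightarrow> 'b \<Rightarrow> 'e) \<Rightarrow> bool" where
  "parseval_frame U k s \<longleftrightarrow>
     (\<forall>i<k. continuous_map (subtopology B U) (total E) (s i)) \<and>
     (\<forall>i<k. \<forall>x\<in>U. s i x \<in> fibre E x) \<and>
     (\<forall>x\<in>U. \<forall>v\<in>fibre E x. \<forall>w\<in>fibre E x.
        vinner E v w = (\<Sum>i<k. vinner E v (s i x) * vinner E (s i x) w))"

text \<open>
  A Parseval family of unit vectors is orthonormal: the identity for \<open>v = w = s\<^sub>j\<close> reads
  \<open>1 = 1 + \<Sum>\<^sub>i\<^sub>\<noteq>\<^sub>j |\<langle>s\<^sub>j, s\<^sub>i\<rangle>|\<^sup>2\<close>.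
\<close>

definition orthonormal_frame :: "'b set \<Rightarrow> nat \<Rightarrow> (nat \<Rightarrow> 'b \<Rightarrow> 'e) \<Rightarrow> bool" where
  "orthonormal_frame U k s \<longleftrightarrow> parseval_frame U k s \<and>
     (\<forall>i<k. \<forall>x\<in>U. vinner E (s i x) (s i x) = 1)"

end

context trivialized_bundle begin

lemma coord_fibre_sum:
  "\<lbrakk>x \<in> U; j < k; \<And>i. i < m \<Longrightarrow> s i \<in> fibre E x\<rbrakk>
    \<Longrightarrow> coord (fibre_sum E x c s m) j = (\<Sum>i<m. c i * coord (s i) j)"
proof (induction m)
  case 0
  then show ?case by (simp add: coord_zero)
next
  case (Suc m)
  have "x \<in> topspace B" using Suc.prems(1) U_subset by blast
  then have "fibre_sum E x c s m \<in> fibre E x" "vscale E (c m) (s m) \<in> fibre E x"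
    using Suc.prems(3) by (auto intro!: fibre_sum_in_fibre scale_in_fibre)
  then show ?case
    using Suc by (simp add: coord_add[of x] coord_scale[of x])
qed

text \<open>
  The invariant of the Gram--Schmidt process. The triangular shape of the coordinates records that
  the first \<open>m\<close> vectors have the same span as the first \<open>m\<close> basis vectors of the trivialization; it
  keeps the next vector from vanishing and yields completeness when \<open>m = k\<close>.
\<close>

definition triangular_frame :: "nat \<Rightarrow> (nat \<Rightarrow> 'a \<Rightarrow> 'b) \<Rightarrow> bool" where
  "triangular_frame m s \<longleftrightarrow>
     (\<forall>i<m. continuous_map (subtopology B U) (total E) (s i)) \<and>
     (\<forall>i<m. \<forall>x\<in>U. s i x \<in> fibre E x) \<and>
     (\<forall>i<m. \<forall>j<m. \<forall>x\<in>U. vinner E (s i x) (s j x) = (if i = j then 1 else 0)) \<and>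
     (\<forall>i<m. \<forall>x\<in>U. coord (s i x) i \<noteq> 0) \<and>
     (\<forall>i<m. \<forall>x\<in>U. \<forall>j<k. i < j \<longrightarrow> coord (s i x) j = 0)"

lemma gram_schmidt: "m \<le> k \<Longrightarrow> \<exists>s. triangular_frame m s"
proof (induction m)
  case 0
  then show ?case by (auto simp: triangular_frame_def)
next
  case (Suc m)
  then obtain s where s: "triangular_frame m s" by (meson Suc_leD)
  then have cont: "\<And>i. i < m \<Longrightarrow> continuous_map (subtopology B U) (total E) (s i)"
    and fib: "\<And>i x. i < m \<Longrightarrow> x \<in> U \<Longrightarrow> s i x \<in> fibre E x"
    and on: "\<And>i j x. i < m \<Longrightarrow> j < m \<Longrightarrow> x \<in> U \<Longrightarrow>
      vinner E (s i x) (s j x) = (if i = j then 1 else 0)"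
    and co: "\<And>i x. i < m \<Longrightarrow> x \<in> U \<Longrightarrow> coord (s i x) i \<noteq> 0"
    and co0: "\<And>i j x. i < m \<Longrightarrow> x \<in> U \<Longrightarrow> j < k \<Longrightarrow> i < j \<Longrightarrow> coord (s i x) j = 0"
    unfolding triangular_frame_def by blast+
  have m: "m < k" using Suc.prems by simp
  let ?BU = "subtopology B U"
  have UB: "x \<in> topspace B" if "x \<in> U" for x using that U_subset by blast
  have "\<forall>x\<in>U. \<exists>u\<in>fibre E x. \<forall>i<k. coord u i = (\<lambda>i\<in>{..<k}. if i = m then 1 else 0) i"
    by (intro ballI ex_coord restrict_extensional)
  then have "\<forall>x\<in>U. \<exists>u. u\<in>fibre E x \<and> (\<forall>i<k. coord u i = (if i = m then 1 else 0))"
    by fastforce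
  then obtain e where e: "\<And>x. x \<in> U \<Longrightarrow> e x \<in> fibre E x"
    and ce: "\<And>x i. x \<in> U \<Longrightarrow> i < k \<Longrightarrow> coord (e x) i = (if i = m then 1 else 0)"
    by metis
  have econt: "continuous_map ?BU (total E) e"
  proof (rule continuous_of_coord[where g = "\<lambda>x. x"])
    fix i assume "i < k"
    then show "continuous_map ?BU euclidean (\<lambda>x. coord (e x) i)"
      by (rule_tac continuous_map_eq[of _ _ "\<lambda>_. if i = m then 1 else 0"]) (auto simp: ce)
  qed (use e in \<open>auto simp: continuous_map_from_subtopology\<close>)
  define p where "p x = fibre_sum E x (\<lambda>i. vinner E (e x) (s i x)) (\<lambda>i. s i x) m" for x
  define u where "u x = vadd E (e x) (vscale E (- 1) (p x))" for x
  define N where "N x = Re (vinner E (u x) (u x))" for x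
  define t where "t x = vscale E (of_real (inverse (sqrt (N x)))) (u x)" for x
  have p: "p x \<in> fibre E x" if "x \<in> U" for x
    unfolding p_def using fib that UB by (intro fibre_sum_in_fibre) auto
  have u: "u x \<in> fibre E x" if "x \<in> U" for x
    unfolding u_def using p e that by (intro add_in_fibre scale_in_fibre) auto
  have t: "t x \<in> fibre E x" if "x \<in> U" for x
    unfolding t_def using u that by (intro scale_in_fibre) auto
  have pr: "proj E (s i x) = x" "proj E (e x) = x" "proj E (p x) = x" "proj E (u x) = x"
    if "x \<in> U" "i < m" for x i
    using that fib e p u in_fibre(4) by blast+
  have pr': "proj E (e x) = x" "proj E (p x) = x" "proj E (vscale E c (p x)) = x" "proj E (u x) = x"
    if "x \<in> U" for x c
    using that e p u in_fibre(4) scale_in_fibre by blast+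
  have pcont: "continuous_map ?BU (total E) p"
    unfolding p_def
    by (intro fibre_sum_continuous inner_continuous cont econt) (auto simp: pr fib)
  have ucont: "continuous_map ?BU (total E) u"
    unfolding u_def
    by (intro vadd_continuous vscale_continuous econt pcont) (auto simp: pr')
  have cu: "coord (u x) j = (if j = m then 1 else 0)" if "x \<in> U" "j < k" "m \<le> j" for x j
  proof -
    have "coord (p x) j = 0"
      unfolding p_def using that fib co0 by (subst coord_fibre_sum) (auto intro!: sum.neutral)
    then show ?thesis
      unfolding u_def using that e p scale_in_fibre ce
      by (simp add: coord_add[of x] coord_scale[of x])
  qed
  have Npos: "0 < N x" if x: "x \<in> U" for x
    unfolding N_def
  proof (rule inner_pos[OF u[OF x]])
    show "u x \<noteq> vzero E x"
      using cu[OF x m] coord_zero[OF x m] by auto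
  qed
  have uu: "vinner E (u x) (u x) = of_real (N x)" if "x \<in> U" for x
    using inner_self_real[OF u[OF that]] by (simp add: N_def)
  have us: "vinner E (u x) (s j x) = 0" if x: "x \<in> U" and j: "j < m" for x j
  proof -
    have "vinner E (p x) (s j x) = (\<Sum>i<m. vinner E (e x) (s i x) * vinner E (s i x) (s j x))"
      unfolding p_def using x j fib by (intro inner_fibre_sum_left) auto
    also have "\<dots> = (\<Sum>i<m. if i = j then vinner E (e x) (s j x) else 0)"
      using on x j by (intro sum.cong) auto
    finally have "vinner E (p x) (s j x) = vinner E (e x) (s j x)"
      using j by simp
    then show ?thesis
      unfolding u_def using x j e p fib scale_in_fibre
      by (simp add: inner_add_left[of _ x] inner_scale_left[of _ x])
  qed
  have ts: "vinner E (t x) (s j x) = 0" if "x \<in> U" "j < m" for x j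
    unfolding t_def using that u fib us by (simp add: inner_scale_left[of _ x])
  have st: "vinner E (s j x) (t x) = 0" if "x \<in> U" "j < m" for x j
    using inner_commute[OF t[OF that(1)] fib[OF that(2,1)]] ts[OF that] by simp
  have tt: "vinner E (t x) (t x) = 1" if x: "x \<in> U" for x
  proof -
    have "vinner E (t x) (t x) = of_real (inverse (sqrt (N x)) * inverse (sqrt (N x)) * N x)"
      unfolding t_def using u[OF x] scale_in_fibre[OF u[OF x]] uu[OF x]
      by (simp add: inner_scale_left[of _ x] inner_scale_right[of _ x])
    also have "inverse (sqrt (N x)) * inverse (sqrt (N x)) * N x = 1"
      using Npos[OF x] by (simp add: field_simps)
    finally show ?thesis by simp
  qed
  have tcont: "continuous_map ?BU (total E) t"
    unfolding t_def
  proof (intro vscale_continuous ucont continuous_map_of_real continuous_map_inverse_sqrt)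
    show "continuous_map ?BU euclideanreal N"
      unfolding N_def by (intro continuous_map_Re inner_continuous ucont) auto
  qed (use Npos in auto)
  have ct: "coord (t x) j = of_real (inverse (sqrt (N x))) * (if j = m then 1 else 0)"
    if "x \<in> U" "j < k" "m \<le> j" for x j
    unfolding t_def using that u cu by (simp add: coord_scale[of x])
  have ctm: "coord (t x) m \<noteq> 0" if "x \<in> U" for x
    using ct[OF that m] Npos[OF that] by simp
  define s' where "s' i = (if i = m then t else s i)" for i
  show ?case
    unfolding triangular_frame_def
  proof (intro exI[of _ s'] conjI allI impI ballI)
    fix i assume "i < Suc m"
    then show "continuous_map ?BU (total E) (s' i)"
      using cont tcont by (auto simp: s'_def)
  qed (use m fib t on tt ts st co co0 ct ctm in \<open>auto simp: s'_def less_Suc_eq\<close>)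
qed

text \<open>
  Completeness comes by induction on \<open>m\<close> for vectors \<open>v\<close> whose coordinates from the \<open>m\<close>-th on vanish:
  a multiple of \<open>s\<^sub>m\<close> removes the last coordinate, and orthonormality identifies its coefficient as
  \<open>\<langle>v, s\<^sub>m\<rangle>\<close>.
\<close>

lemma ex_orthonormal_frame: "\<exists>s. orthonormal_frame U k s"
proof -
  obtain s where "triangular_frame k s" using gram_schmidt[of k] by auto
  then have cont: "\<And>i. i < k \<Longrightarrow> continuous_map (subtopology B U) (total E) (s i)"
    and fib: "\<And>i x. i < k \<Longrightarrow> x \<in> U \<Longrightarrow> s i x \<in> fibre E x"
    and on: "\<And>i j x. i < k \<Longrightarrow> j < k \<Longrightarrow> x \<in> U \<Longrightarrow>
      vinner E (s i x) (s j x) = (if i = j then 1 else 0)"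
    and co: "\<And>i x. i < k \<Longrightarrow> x \<in> U \<Longrightarrow> coord (s i x) i \<noteq> 0"
    and co0: "\<And>i j x. i < k \<Longrightarrow> x \<in> U \<Longrightarrow> j < k \<Longrightarrow> i < j \<Longrightarrow> coord (s i x) j = 0"
    unfolding triangular_frame_def by blast+
  have "\<forall>w\<in>fibre E x. vinner E v w = (\<Sum>i<m. vinner E v (s i x) * vinner E (s i x) w)"
    if "m \<le> k" "x \<in> U" "v \<in> fibre E x" "\<And>j. j < k \<Longrightarrow> m \<le> j \<Longrightarrow> coord v j = 0" for m x v
    using that
  proof (induction m arbitrary: v)
    case 0
    then have "v = vzero E x"
      by (intro fibre_eq_coordI[of x]) (use U_subset in \<open>auto intro: zero_in_fibre simp: coord_zero\<close>)
    then show ?case by (simp add: inner_zero_left)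
  next
    case (Suc m)
    have m: "m < k" and x: "x \<in> U" and v: "v \<in> fibre E x" using Suc.prems by auto
    define c where "c = coord v m / coord (s m x) m"
    define v' where "v' = vadd E v (vscale E (- c) (s m x))"
    have sm: "s m x \<in> fibre E x" using fib m x by blast
    have v': "v' \<in> fibre E x"
      unfolding v'_def by (intro add_in_fibre scale_in_fibre v sm)
    have inn: "vinner E v' w = vinner E v w - c * vinner E (s m x) w" if "w \<in> fibre E x" for w
      unfolding v'_def using v sm scale_in_fibre[OF sm] that
      by (simp add: inner_add_left[of _ x] inner_scale_left[of _ x])
    have "coord v' j = 0" if "j < k" "m \<le> j" for j
    proof -
      have "coord v' j = coord v j - c * coord (s m x) j"
        unfolding v'_def using v sm scale_in_fibre[OF sm] that x
        by (simp add: coord_add[of x] coord_scale[of x])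
      then show ?thesis
        using that Suc.prems(4)[of j] co[OF m x] co0[OF m x, of j]
        by (cases "j = m") (auto simp: c_def)
    qed
    then have IH: "vinner E v' w = (\<Sum>i<m. vinner E v' (s i x) * vinner E (s i x) w)"
      if "w \<in> fibre E x" for w
      using Suc.IH[OF _ x v'] m that by auto
    have "vinner E v' (s i x) = vinner E v (s i x)" if "i < m" for i
      using inn[of "s i x"] fib[of i x] on[of m i x] that m x by auto
    then have *: "vinner E v w = (\<Sum>i<m. vinner E v (s i x) * vinner E (s i x) w) + c * vinner E (s m x) w"
      if "w \<in> fibre E x" for w
      using IH[OF that] inn[OF that] by (simp add: algebra_simps)
    have "(\<Sum>i<m. vinner E v (s i x) * vinner E (s i x) (s m x)) = 0"
      using on m x by (intro sum.neutral) auto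
    then have "c = vinner E v (s m x)"
      using *[OF sm] on[OF m m x] by simp
    then show ?case
      using * by simp
  qed
  then show ?thesis
    using cont fib on unfolding orthonormal_frame_def parseval_frame_def
    by (intro exI[of _ s]) auto
qed

end

context hermitian_bundle begin

lemma parseval_frameD:
  assumes "parseval_frame U k s"
  shows "i < k \<Longrightarrow> continuous_map (subtopology B U) (total E) (s i)"
    and "i < k \<Longrightarrow> x \<in> U \<Longrightarrow> s i x \<in> fibre E x"
    and "x \<in> U \<Longrightarrow> v \<in> fibre E x \<Longrightarrow> w \<in> fibre E x \<Longrightarrow>
      vinner E v w = (\<Sum>i<k. vinner E v (s i x) * vinner E (s i x) w)"
  using assms unfolding parseval_frame_def by blast+

lemma orthonormal_frame_subset:
  assumes "orthonormal_frame U k s" "W \<subseteq> U"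
  shows "orthonormal_frame W k s"
proof -
  have "continuous_map (subtopology B W) (total E) (s i)" if "i < k" for i
    using assms that unfolding orthonormal_frame_def parseval_frame_def
    by (meson continuous_map_from_subtopology_mono)
  then show ?thesis
    using assms unfolding orthonormal_frame_def parseval_frame_def by (simp add: subset_iff)
qed

text \<open>
  On the union \<open>O\<^sub>m\<close> of the disjoint sets of colour \<open>m\<close> the orthonormal frames glue. Multiplying them
  by a function \<open>p\<^sub>m\<close> whose support lies in \<open>O\<^sub>m\<close> gives global sections, and \<open>\<Sum>\<^sub>m p\<^sub>m\<^sup>2 = 1\<close> makes
  the family of all of them Parseval. The squared norms sum to \<open>\<Sum>\<^sub>m p\<^sub>m\<^sup>2 n = n\<close>, which later gives
  the rank as a trace.
\<close>

theorem finite_parseval_frame: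
  assumes top: "second_countable B" "normal_space B" "regular_space B" "t1_space B"
    and dim: "covering_dim_le B d" and rank: "has_rank B E n"
  shows "\<exists>N s. parseval_frame (topspace B) N s \<and>
    (\<forall>x\<in>topspace B. (\<Sum>i<N. vinner E (s i x) (s i x)) = of_nat n)"
proof -
  define \<U> where "\<U> = {U. openin B U \<and> (\<exists>s. orthonormal_frame U n s)}"
  have "\<exists>U\<in>\<U>. x \<in> U" if x: "x \<in> topspace B" for x
  proof -
    obtain U \<phi> where U: "openin B U" "x \<in> U" "local_trivialization B E U n \<phi>"
      using rank x unfolding has_rank_def locally_trivial_at_def by blast
    then interpret trivialized_bundle B E U n \<phi>
      by unfold_locales auto
    show ?thesis
      using U ex_orthonormal_frame by (auto simp: \<U>_def)
  qed
  then have "\<Union>\<U> = topspace B"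
    unfolding \<U>_def using openin_subset by fastforce
  moreover have "openin B U" if "U \<in> \<U>" for U
    using that by (simp add: \<U>_def)
  ultimately have "\<exists>\<W> :: nat \<Rightarrow> 'b set set.
      (\<forall>m. \<forall>W\<in>\<W> m. openin B W \<and> (\<exists>U\<in>\<U>. W \<subseteq> U)) \<and>
      (\<forall>m. pairwise disjnt (\<W> m)) \<and> (\<Union>m\<in>{1..d+1}. \<Union>(\<W> m)) = topspace B"
    by (intro finite_dimension_imp_finite_colouring[OF top dim])
  then obtain \<W> :: "nat \<Rightarrow> 'b set set" where
      "\<forall>m. \<forall>W\<in>\<W> m. openin B W \<and> (\<exists>U\<in>\<U>. W \<subseteq> U)"
      "\<forall>m. pairwise disjnt (\<W> m)" "(\<Union>m\<in>{1..d+1}. \<Union>(\<W> m)) = topspace B"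
    by (elim exE conjE) (rule that)
  then have \<W>: "\<And>m W. W \<in> \<W> m \<Longrightarrow> openin B W \<and> (\<exists>U\<in>\<U>. W \<subseteq> U)"
      "\<And>m. pairwise disjnt (\<W> m)" "(\<Union>m\<in>{1..d+1}. \<Union>(\<W> m)) = topspace B"
    by blast+
  have "\<exists>s. orthonormal_frame W n s" if "W \<in> \<W> m" for W m
    using \<W>(1)[OF that] orthonormal_frame_subset unfolding \<U>_def by blast
  then obtain fr where fr: "\<And>m W. W \<in> \<W> m \<Longrightarrow> orthonormal_frame W n (fr W)"
    by metis
  define M where "M = {1..d+1}"
  define O' where "O' m = \<Union>(\<W> m)" for m
  have O'op: "openin B (O' m)" for m
    unfolding O'_def using \<W>(1) by (intro openin_Union) auto
  obtain r where rc: "\<And>m. continuous_map B euclideanreal (r m)"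
    and r: "\<And>m x. x \<in> topspace B \<Longrightarrow> 0 \<le> r m x \<and> r m x \<le> 1 \<and> (0 < r m x \<longleftrightarrow> x \<in> O' m)"
    using open_eq_positivity_set[OF top O'op] by metis
  \<comment> \<open>\<open>R\<close> is half the mean value of the \<open>r\<^sub>m\<close>. Cutting \<open>r\<^sub>m\<close> off at \<open>R\<close> makes \<open>p\<^sub>m\<close> vanish on the
    open set \<open>{r\<^sub>m < R}\<close>, which contains the complement of \<open>O\<^sub>m\<close>, while at every point some
    \<open>r\<^sub>m\<close> still exceeds \<open>R\<close>.\<close>
  define R where "R x = (\<Sum>m\<in>M. r m x) / (2 * (d + 1))" for x
  define q where "q m x = max 0 (r m x - R x)" for m x
  define Q where "Q x = (\<Sum>m\<in>M. (q m x)\<^sup>2)" for x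
  define p where "p m x = q m x * inverse (sqrt (Q x))" for m x
  have M: "finite M" "card M = d + 1" by (auto simp: M_def)
  have Rpos: "0 < R x" and ex: "\<exists>m\<in>M. R x < r m x" if x: "x \<in> topspace B" for x
  proof -
    obtain m where m: "m \<in> M" "x \<in> O' m"
      using x unfolding \<W>(3)[symmetric] M_def O'_def by blast
    then have "0 < (\<Sum>m\<in>M. r m x)"
      using r[OF x] M by (intro sum_pos2[of M m]) auto
    then show R: "0 < R x" by (simp add: R_def)
    show "\<exists>m\<in>M. R x < r m x"
    proof (rule ccontr)
      assume "\<not> ?thesis"
      then have "(\<Sum>m\<in>M. r m x) \<le> (\<Sum>m\<in>M. R x)"
        by (intro sum_mono) (auto simp: not_less)
      also have "\<dots> = (\<Sum>m\<in>M. r m x) / 2"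
        using M by (simp add: R_def field_simps)
      finally show False
        using \<open>0 < (\<Sum>m\<in>M. r m x)\<close> by simp
    qed
  qed
  have Rc: "continuous_map B euclideanreal R"
    unfolding R_def divide_inverse using rc M by (intro continuous_intros) auto
  have qc: "continuous_map B euclideanreal (q m)" for m
    unfolding q_def by (intro continuous_map_real_max continuous_map_diff rc Rc) auto
  have Qpos: "0 < Q x" if x: "x \<in> topspace B" for x
  proof -
    obtain m where "m \<in> M" "R x < r m x" using ex[OF x] by blast
    then show ?thesis
      unfolding Q_def using M by (intro sum_pos2[of M m]) (auto simp: q_def)
  qed
  have pc: "continuous_map B euclideanreal (p m)" for m
    unfolding p_def Q_def power2_eq_square
    by (intro continuous_map_real_mult continuous_map_inverse_sqrt qc continuous_map_sum M)
      (use Qpos in \<open>simp add: Q_def power2_eq_square\<close>)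
  have psum: "(\<Sum>m\<in>M. (p m x)\<^sup>2) = 1" if x: "x \<in> topspace B" for x
  proof -
    have "(\<Sum>m\<in>M. (p m x)\<^sup>2) = (\<Sum>m\<in>M. (q m x)\<^sup>2) * (inverse (sqrt (Q x)))\<^sup>2"
      by (simp add: p_def power_mult_distrib sum_distrib_right)
    also have "\<dots> = Q x * inverse (Q x)"
      using Qpos[OF x] by (simp add: Q_def power_inverse)
    finally show ?thesis using Qpos[OF x] by simp
  qed
  have p0: "p m x = 0" if "r m x \<le> R x" for m x
    using that by (simp add: p_def q_def)
  have p0': "p m x = 0" if "x \<in> topspace B" "x \<notin> O' m" for m x
    using r[OF that(1), of m] that(2) Rpos[OF that(1)] by (intro p0) auto
  define Wx where "Wx m x = (THE W. W \<in> \<W> m \<and> x \<in> W)" for m x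
  have Wx: "Wx m x = W" if "W \<in> \<W> m" "x \<in> W" for m x W
    unfolding Wx_def using that \<W>(2)[of m]
    by (intro the_equality) (auto simp: pairwise_def disjnt_iff)
  define \<sigma> where "\<sigma> m i x = (if x \<in> O' m then vscale E (of_real (p m x)) (fr (Wx m x) i x) else vzero E x)"
    for m i x
  have \<sigma>W: "\<sigma> m i x = vscale E (of_real (p m x)) (fr W i x)" if "W \<in> \<W> m" "x \<in> W" for m i x W
    using that Wx[OF that] by (auto simp: \<sigma>_def O'_def)
  have frP: "parseval_frame W n (fr W)" if "W \<in> \<W> m" for m W
    using fr[OF that] by (simp add: orthonormal_frame_def)
  have frfib: "fr W i x \<in> fibre E x" if "W \<in> \<W> m" "x \<in> W" "i < n" for m i x W
    using parseval_frameD(2)[OF frP] that by blast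
  have \<sigma>fib: "\<sigma> m i x \<in> fibre E x" if "i < n" "x \<in> topspace B" for m i x
  proof (cases "x \<in> O' m")
    case True
    then obtain W where "W \<in> \<W> m" "x \<in> W" by (auto simp: O'_def)
    then show ?thesis using \<sigma>W frfib that(1) scale_in_fibre by metis
  qed (use zero_in_fibre that in \<open>simp add: \<sigma>_def\<close>)
  have \<sigma>0: "\<sigma> m i x = vzero E x" if x: "x \<in> topspace B" and "i < n" "p m x = 0" for m i x
  proof (cases "x \<in> O' m")
    case True
    then obtain W where "W \<in> \<W> m" "x \<in> W" by (auto simp: O'_def)
    then show ?thesis using \<sigma>W[of W m x i] frfib[of W m x i] that scale_zero by simp
  qed (simp add: \<sigma>_def)
  have \<sigma>c: "continuous_map B (total E) (\<sigma> m i)" if i: "i < n" for m i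
  proof -
    define Z where "Z = {x \<in> topspace B. R x - r m x \<in> {0<..}}"
    have Z: "openin B Z"
      unfolding Z_def using rc Rc
      by (intro openin_continuous_map_preimage[of _ euclideanreal] continuous_map_diff) auto
    show ?thesis
    proof (rule pasting_lemma[of "insert Z (\<W> m)" B id _ "\<lambda>_. \<sigma> m i"])
      fix W assume W: "W \<in> insert Z (\<W> m)"
      show "openin B (id W)" using W Z \<W>(1) by auto
      show "continuous_map (subtopology B (id W)) (total E) (\<sigma> m i)"
      proof (cases "W \<in> \<W> m")
        case True
        have "continuous_map (subtopology B W) (total E) (\<lambda>x. vscale E (of_real (p m x)) (fr W i x))"
          using parseval_frameD(1)[OF frP[OF True] i] pc
          by (intro vscale_continuous continuous_map_of_real) (auto intro: continuous_map_from_subtopology)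
        then have "continuous_map (subtopology B W) (total E) (\<sigma> m i)"
          by (rule continuous_map_eq) (use \<sigma>W[OF True] in auto)
        then show ?thesis by simp
      next
        case False
        then have [simp]: "W = Z" using W by simp
        have "continuous_map (subtopology B Z) (total E) (\<lambda>x. vzero E x)"
          by (intro vzero_continuous) simp
        then have "continuous_map (subtopology B Z) (total E) (\<sigma> m i)"
          by (rule continuous_map_eq) (use \<sigma>0[OF _ i] p0 in \<open>auto simp: Z_def\<close>)
        then show ?thesis by simp
      qed
    next
      fix x assume x: "x \<in> topspace B"
      show "\<exists>W. W \<in> insert Z (\<W> m) \<and> x \<in> id W \<and> \<sigma> m i x = \<sigma> m i x"
      proof (cases "x \<in> O' m")
        case False
        then have "x \<in> Z"
          using r[OF x, of m] Rpos[OF x] x by (auto simp: Z_def)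
        then show ?thesis by auto
      qed (auto simp: O'_def)
    qed simp
  qed
  have pars: "(\<Sum>i<n. vinner E v (\<sigma> m i x) * vinner E (\<sigma> m i x) w) = of_real ((p m x)\<^sup>2) * vinner E v w"
    if x: "x \<in> topspace B" and v: "v \<in> fibre E x" and w: "w \<in> fibre E x" for m x v w
  proof (cases "x \<in> O' m")
    case True
    then obtain W where W: "W \<in> \<W> m" "x \<in> W" by (auto simp: O'_def)
    have "(\<Sum>i<n. vinner E v (\<sigma> m i x) * vinner E (\<sigma> m i x) w)
        = (\<Sum>i<n. of_real ((p m x)\<^sup>2) * (vinner E v (fr W i x) * vinner E (fr W i x) w))"
      using v w frfib[OF W]
      by (intro sum.cong) (auto simp: \<sigma>W[OF W] inner_scale_left[of _ x] inner_scale_right[of _ x] power2_eq_square)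
    also have "\<dots> = of_real ((p m x)\<^sup>2) * vinner E v w"
      using parseval_frameD(3)[OF frP[OF W(1)] W(2) v w] by (simp add: sum_distrib_left)
    finally show ?thesis .
  qed (use v w p0'[OF x] in \<open>auto simp: \<sigma>_def inner_zero_left inner_zero_right\<close>)
  have nrm: "(\<Sum>i<n. vinner E (\<sigma> m i x) (\<sigma> m i x)) = of_real ((p m x)\<^sup>2) * of_nat n"
    if x: "x \<in> topspace B" for m x
  proof (cases "x \<in> O' m")
    case True
    then obtain W where W: "W \<in> \<W> m" "x \<in> W" by (auto simp: O'_def)
    have "(\<Sum>i<n. vinner E (\<sigma> m i x) (\<sigma> m i x)) = (\<Sum>i<n. of_real ((p m x)\<^sup>2))"
      using frfib[OF W] fr[OF W(1)] W(2) scale_in_fibre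
      by (intro sum.cong) (auto simp: \<sigma>W[OF W] inner_scale_left[of _ x] inner_scale_right[of _ x]
          orthonormal_frame_def power2_eq_square)
    then show ?thesis by simp
  qed (use zero_in_fibre[OF x] p0'[OF x] in \<open>auto simp: \<sigma>_def inner_zero_left\<close>)
  obtain h N where h: "bij_betw h {..<N::nat} (M \<times> {..<n})"
    using ex_bij_betw_nat_finite[of "M \<times> {..<n}"] M by (auto simp: lessThan_atLeast0)
  define s where "s j = \<sigma> (fst (h j)) (snd (h j))" for j
  have reindex: "(\<Sum>j<N. f (fst (h j)) (snd (h j))) = (\<Sum>m\<in>M. \<Sum>i<n. f m i)" for f :: "nat \<Rightarrow> nat \<Rightarrow> complex"
    using sum.reindex_bij_betw[OF h, of "\<lambda>(m, i). f m i"]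
    by (simp add: case_prod_beta sum.cartesian_product)
  have hn: "snd (h j) < n" if "j < N" for j
    using h that by (auto simp: bij_betw_def image_subset_iff set_eq_iff image_iff) (metis lessThan_iff mem_Sigma_iff prod.collapse)
  have psumC: "(\<Sum>m\<in>M. of_real ((p m x)\<^sup>2)) = (1::complex)" if "x \<in> topspace B" for x
    using arg_cong[OF psum[OF that], of complex_of_real] by simp
  have "parseval_frame (topspace B) N s"
    unfolding parseval_frame_def
  proof (intro conjI ballI allI impI)
    fix x v w assume x: "x \<in> topspace B" and v: "v \<in> fibre E x" and w: "w \<in> fibre E x"
    show "vinner E v w = (\<Sum>i<N. vinner E v (s i x) * vinner E (s i x) w)"
      unfolding s_def reindex[of "\<lambda>m i. vinner E v (\<sigma> m i x) * vinner E (\<sigma> m i x) w"]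
        pars[OF x v w] sum_distrib_right[symmetric] psumC[OF x] by simp
  qed (use hn \<sigma>c \<sigma>fib in \<open>auto simp: s_def\<close>)
  moreover have "(\<Sum>i<N. vinner E (s i x) (s i x)) = of_nat n" if x: "x \<in> topspace B" for x
    unfolding s_def reindex[of "\<lambda>m i. vinner E (\<sigma> m i x) (\<sigma> m i x)"] nrm[OF x]
      sum_distrib_right[symmetric] psumC[OF x] by simp
  ultimately show ?thesis by blast
qed

end

section \<open>The bundle of ranges of a family of projections\<close>

text \<open>
  The subbundle of the trivial bundle with fibre \<open>\<complex>\<^sup>N\<close> whose fibre over \<open>b\<close> is the set of fixed vectors
  of \<open>P b\<close>, that is, its range when \<open>P b\<close> is a projection. All vectors are extensional, as in
  \<open>complex_space\<close>.
\<close>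

definition image_bundle ::
    "'k topology \<Rightarrow> nat \<Rightarrow> ('k \<Rightarrow> nat \<Rightarrow> nat \<Rightarrow> complex) \<Rightarrow> ('k, 'k \<times> (nat \<Rightarrow> complex)) vbundle" where
  "image_bundle K N P =
     \<lparr>total = subtopology (prod_topology K (complex_space N))
        {(b, w). \<forall>i<N. (\<Sum>j<N. P b i j * w j) = w i},
      proj = fst,
      vzero = (\<lambda>b. (b, \<lambda>i\<in>{..<N}. 0)),
      vadd = (\<lambda>(b, v) (_, w). (b, \<lambda>i\<in>{..<N}. v i + w i)),
      vscale = (\<lambda>c (b, w). (b, \<lambda>i\<in>{..<N}. c * w i)),
      vinner = (\<lambda>(_, v) (_, w). \<Sum>i<N. v i * cnj (w i))\<rparr>"

text \<open>
  The trace of a projection is the dimension of its range. Fixing the rank by means of the trace makes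
  it a closed condition on the matrix, which survives passage to the closure.
\<close>

locale projection_family =
  fixes K :: "'k topology" and N n :: nat and P :: "'k \<Rightarrow> nat \<Rightarrow> nat \<Rightarrow> complex"
  assumes P_continuous: "\<lbrakk>i < N; j < N\<rbrakk> \<Longrightarrow> continuous_map K euclidean (\<lambda>b. P b i j)"
    and P_idem: "\<lbrakk>b \<in> topspace K; i < N; j < N\<rbrakk> \<Longrightarrow> (\<Sum>k<N. P b i k * P b k j) = P b i j"
    and P_adjoint: "\<lbrakk>b \<in> topspace K; i < N; j < N\<rbrakk> \<Longrightarrow> P b j i = cnj (P b i j)"
    and P_trace: "b \<in> topspace K \<Longrightarrow> (\<Sum>i<N. P b i i) = of_nat n"
begin

abbreviation "W \<equiv> image_bundle K N P"

definition "img b = {w \<in> extensional {..<N}. \<forall>i<N. (\<Sum>j<N. P b i j * w j) = w i}"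

lemma image_ext: "w \<in> img b \<Longrightarrow> w \<in> extensional {..<N}"
  by (simp add: img_def)

lemma image_fix: "w \<in> img b \<Longrightarrow> i < N \<Longrightarrow> (\<Sum>j<N. P b i j * w j) = w i"
  by (simp add: img_def)

lemma topspace_total: "topspace (total W) = {(b, w). b \<in> topspace K \<and> w \<in> img b}"
  by (auto simp: image_bundle_def complex_space_def img_def PiE_def)

lemma fibre_W: "b \<in> topspace K \<Longrightarrow> fibre W b = Pair b ` img b"
  unfolding fibre_def topspace_total by (auto simp: image_bundle_def)

lemma image_zero: "(\<lambda>i\<in>{..<N}. 0) \<in> img b"
  by (simp add: img_def)

lemma image_add:
  assumes "v \<in> img b" "w \<in> img b" shows "(\<lambda>i\<in>{..<N}. v i + w i) \<in> img b"
proof -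
  have "(\<Sum>j<N. P b i j * (v j + w j)) = v i + w i" if "i < N" for i
    using image_fix[OF assms(1) that] image_fix[OF assms(2) that]
    by (simp add: distrib_left sum.distrib)
  then show ?thesis by (simp add: img_def cong: sum.cong_simp)
qed

lemma image_scale:
  assumes "w \<in> img b" shows "(\<lambda>i\<in>{..<N}. c * w i) \<in> img b"
proof -
  have "(\<Sum>j<N. P b i j * (c * w j)) = c * w i" if "i < N" for i
  proof -
    have "(\<Sum>j<N. P b i j * (c * w j)) = c * (\<Sum>j<N. P b i j * w j)"
      by (simp add: sum_distrib_left mult.left_commute)
    then show ?thesis using image_fix[OF assms that] by simp
  qed
  then show ?thesis by (simp add: img_def cong: sum.cong_simp)
qed

lemma ops_W:
  "vzero W b = (b, \<lambda>i\<in>{..<N}. 0)"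
  "vadd W (b, v) (b', w) = (b, \<lambda>i\<in>{..<N}. v i + w i)"
  "vscale W c (b, w) = (b, \<lambda>i\<in>{..<N}. c * w i)"
  "vinner W (b, v) (b', w) = (\<Sum>i<N. v i * cnj (w i))"
  "proj W = fst"
  by (simp_all add: image_bundle_def)

lemma module_W:
  assumes b: "b \<in> topspace K"
  shows "Module.module complex_ring (fibre_module W b)"
proof (rule moduleI)
  show "cring complex_ring"
    by unfold_locales (auto simp: complex_ring_def Units_def algebra_simps intro: exI[of _ "- _"])
  have simps: "carrier (fibre_module W b) = Pair b ` img b"
    "\<zero>\<^bsub>fibre_module W b\<^esub> = (b, \<lambda>i\<in>{..<N}. 0)"
    "\<And>u v. u \<oplus>\<^bsub>fibre_module W b\<^esub> v = vadd W u v"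
    "\<And>c u. c \<odot>\<^bsub>fibre_module W b\<^esub> u = vscale W c u"
    by (auto simp: fibre_module_def fibre_W[OF b] ops_W)
  have ext: "w = w'" if "w \<in> img b" "w' \<in> extensional {..<N}" "\<And>i. i < N \<Longrightarrow> w i = w' i" for w w'
    using that by (auto intro: extensionalityI image_ext)
  show "abelian_group (fibre_module W b)"
  proof (rule abelian_groupI)
    fix u assume "u \<in> carrier (fibre_module W b)"
    then obtain w where w: "u = (b, w)" "w \<in> img b" by (auto simp: simps)
    show "\<exists>v\<in>carrier (fibre_module W b). v \<oplus>\<^bsub>fibre_module W b\<^esub> u = \<zero>\<^bsub>fibre_module W b\<^esub>"
      by (rule bexI[of _ "(b, \<lambda>i\<in>{..<N}. (- 1) * w i)"])
        (use w image_scale[OF w(2), of "- 1"] in \<open>auto simp: simps ops_W\<close>)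
    show "\<zero>\<^bsub>fibre_module W b\<^esub> \<oplus>\<^bsub>fibre_module W b\<^esub> u = u"
      using w by (auto simp: simps ops_W intro!: ext[symmetric])
  qed (auto simp: simps ops_W image_add image_zero add_ac intro!: restrict_ext)
  show "\<one>\<^bsub>complex_ring\<^esub> \<odot>\<^bsub>fibre_module W b\<^esub> u = u" if "u \<in> carrier (fibre_module W b)" for u
    using that by (auto simp: simps ops_W complex_ring_def intro!: ext[symmetric])
qed (auto simp: complex_ring_def fibre_module_def fibre_W[OF b] ops_W image_scale algebra_simps
      intro!: restrict_ext)

lemma inner_product_W:
  assumes b: "b \<in> topspace K"
  shows "inner_product_on_fibre W b"
  unfolding inner_product_on_fibre_def fibre_W[OF b]
proof (intro conjI ballI allI impI)
  fix u v w assume "u \<in> Pair b ` img b" "v \<in> Pair b ` img b" "w \<in> Pair b ` img b"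
  then show "vinner W (vadd W u v) w = vinner W u w + vinner W v w"
    by (auto simp: ops_W distrib_right sum.distrib cong: sum.cong_simp)
next
  fix c u v assume "u \<in> Pair b ` img b" "v \<in> Pair b ` img b"
  then show "vinner W (vscale W c u) v = c * vinner W u v"
    by (auto simp: ops_W sum_distrib_left mult.assoc cong: sum.cong_simp)
next
  fix u v assume "u \<in> Pair b ` img b" "v \<in> Pair b ` img b"
  then show "vinner W v u = cnj (vinner W u v)"
    by (auto simp: ops_W mult.commute)
next
  fix u assume "u \<in> Pair b ` img b" "u \<noteq> vzero W b"
  then obtain w where u: "u = (b, w)" and w: "w \<in> img b" "w \<noteq> (\<lambda>i\<in>{..<N}. 0)"
    by (auto simp: ops_W)
  have "\<exists>i<N. w i \<noteq> 0"
    using w(2) extensionalityI[of w "{..<N}" "\<lambda>i\<in>{..<N}. 0"] image_ext[OF w(1)] by fastforce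
  then obtain i where i: "i < N" "w i \<noteq> 0" by blast
  have "0 < (\<Sum>i<N. (cmod (w i))\<^sup>2)"
    using i by (intro sum_pos2[of _ i]) auto
  also have "\<dots> = Re (vinner W u u)"
    unfolding u ops_W Re_sum cmod_power2 by (simp add: power2_eq_square)
  finally show "0 < Re (vinner W u u)" .
qed

lemma coordinate_continuous:
  assumes "continuous_map T (total W) f" "i < N"
  shows "continuous_map T euclidean (\<lambda>t. snd (f t) i)"
  using assms unfolding image_bundle_def complex_space_def
  by (auto simp: continuous_map_in_subtopology continuous_map_pairwise
      continuous_map_componentwise o_def)

lemma continuous_into_total:
  assumes g: "continuous_map T K g" and h: "\<And>t. t \<in> topspace T \<Longrightarrow> h t \<in> img (g t)"
    and hi: "\<And>i. i < N \<Longrightarrow> continuous_map T euclidean (\<lambda>t. h t i)"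
  shows "continuous_map T (total W) (\<lambda>t. (g t, h t))"
proof -
  have "continuous_map T (complex_space N) h"
    unfolding complex_space_def continuous_map_componentwise
    using hi h image_ext by blast
  then show ?thesis
    using g h by (auto simp: image_bundle_def continuous_map_in_subtopology continuous_map_pairwise
        o_def img_def)
qed

lemma inner_continuous_W:
  "continuous_map (subtopology (prod_topology (total W) (total W)) {(u, v). proj W u = proj W v})
    euclidean (\<lambda>(u, v). vinner W u v)" (is "continuous_map ?T _ _")
proof -
  have "continuous_map ?T (total W) fst" "continuous_map ?T (total W) snd"
    by (auto intro: continuous_map_from_subtopology continuous_map_fst continuous_map_snd)
  then have "continuous_map ?T euclidean (\<lambda>t. \<Sum>i<N. snd (fst t) i * cnj (snd (snd t) i))"
    by (intro continuous_map_sum continuous_map_mult_algebra continuous_map_cnj coordinate_continuous) auto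
  moreover have "(\<lambda>(u, v). vinner W u v) = (\<lambda>t. \<Sum>i<N. snd (fst t) i * cnj (snd (snd t) i))"
    by (auto simp: image_bundle_def fun_eq_iff)
  ultimately show ?thesis by simp
qed

text \<open>The length \<open>k\<close> is independent of the rank \<open>n\<close>, since frames are built one section at a time.\<close>

definition local_frame :: "'k set \<Rightarrow> nat \<Rightarrow> (nat \<Rightarrow> 'k \<Rightarrow> nat \<Rightarrow> complex) \<Rightarrow> bool" where
  "local_frame U k s \<longleftrightarrow>
     (\<forall>l<k. \<forall>i<N. continuous_map (subtopology K U) euclidean (\<lambda>b. s l b i)) \<and>
     (\<forall>l<k. \<forall>i<N. \<forall>b\<in>U. (\<Sum>j<N. P b i j * s l b j) = s l b i) \<and>
     (\<forall>l<k. \<forall>m<k. \<forall>b\<in>U. (\<Sum>i<N. s l b i * cnj (s m b i)) = (if l = m then 1 else 0))"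

lemma local_frameD:
  assumes "local_frame U k s"
  shows "l < k \<Longrightarrow> i < N \<Longrightarrow> continuous_map (subtopology K U) euclidean (\<lambda>b. s l b i)"
    and "l < k \<Longrightarrow> i < N \<Longrightarrow> b \<in> U \<Longrightarrow> (\<Sum>j<N. P b i j * s l b j) = s l b i"
    and "l < k \<Longrightarrow> m < k \<Longrightarrow> b \<in> U \<Longrightarrow>
      (\<Sum>i<N. s l b i * cnj (s m b i)) = (if l = m then 1 else 0)"
  using assms unfolding local_frame_def by blast+

text \<open>
  The projection onto the orthogonal complement of \<open>s\<^sub>0, \<dots>, s\<^sub>k\<^sub>-\<^sub>1\<close> in the range of \<open>P b\<close>. Its
  trace is \<open>n - k\<close>. If \<open>k < n\<close>, one of its columns is nonzero and, normalised, extends the frame; if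
  \<open>k = n\<close>, it vanishes and the frame spans.
\<close>

definition residual :: "nat \<Rightarrow> (nat \<Rightarrow> 'k \<Rightarrow> nat \<Rightarrow> complex) \<Rightarrow> 'k \<Rightarrow> nat \<Rightarrow> nat \<Rightarrow> complex" where
  "residual k s b i j = P b i j - (\<Sum>l<k. s l b i * cnj (s l b j))"

context
  fixes U k s
  assumes U: "U \<subseteq> topspace K" and s: "local_frame U k s"
begin

lemma residual_in_image:
  assumes "b \<in> U" "i < N" "j < N"
  shows "(\<Sum>m<N. P b i m * residual k s b m j) = residual k s b i j"
proof -
  have "(\<Sum>m<N. P b i m * (\<Sum>l<k. s l b m * cnj (s l b j)))
      = (\<Sum>l<k. \<Sum>m<N. P b i m * s l b m * cnj (s l b j))"
    by (subst sum.swap) (simp add: sum_distrib_left mult.assoc)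
  also have "\<dots> = (\<Sum>l<k. s l b i * cnj (s l b j))"
    using local_frameD(2)[OF s] assms by (simp add: sum_distrib_right[symmetric])
  finally show ?thesis
    using P_idem[of b i j] U assms
    by (auto simp: residual_def right_diff_distrib sum_subtractf)
qed

lemma residual_orthogonal:
  assumes "b \<in> U" "j < N" "m < k"
  shows "(\<Sum>i<N. residual k s b i j * cnj (s m b i)) = 0"
proof -
  have "(\<Sum>i<N. (\<Sum>l<k. s l b i * cnj (s l b j)) * cnj (s m b i))
      = (\<Sum>l<k. (\<Sum>i<N. s l b i * cnj (s m b i)) * cnj (s l b j))"
    by (simp only: sum_distrib_right, subst sum.swap, simp add: mult_ac)
  also have "\<dots> = (\<Sum>l<k. if l = m then cnj (s m b j) else 0)"
    using local_frameD(3)[OF s] assms by (intro sum.cong) auto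
  also have "\<dots> = cnj (s m b j)"
    using assms by simp
  finally have 1: "(\<Sum>i<N. (\<Sum>l<k. s l b i * cnj (s l b j)) * cnj (s m b i)) = cnj (s m b j)" .
  have "(\<Sum>i<N. P b i j * cnj (s m b i)) = cnj (\<Sum>i<N. P b j i * s m b i)"
    using P_adjoint[of b j] U assms by (auto intro!: sum.cong)
  also have "\<dots> = cnj (s m b j)"
    using local_frameD(2)[OF s] assms by simp
  finally show ?thesis
    using 1 by (simp add: residual_def left_diff_distrib sum_subtractf)
qed

lemma residual_adjoint:
  assumes "b \<in> U" "i < N" "j < N"
  shows "residual k s b j i = cnj (residual k s b i j)"
  using P_adjoint[of b i j] U assms by (auto simp: residual_def mult.commute)

text \<open>This is the diagonal of \<open>R\<^sup>* R = R\<close> for the residual \<open>R\<close>.\<close>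

lemma residual_norm:
  assumes "b \<in> U" "j < N"
  shows "(\<Sum>i<N. residual k s b i j * cnj (residual k s b i j)) = residual k s b j j"
proof -
  have "(\<Sum>i<N. residual k s b i j * cnj (residual k s b i j))
      = (\<Sum>i<N. residual k s b j i * residual k s b i j)"
    using residual_adjoint[OF assms(1) _ assms(2), symmetric] by (intro sum.cong) auto
  also have "\<dots> = (\<Sum>i<N. P b j i * residual k s b i j)
      - (\<Sum>i<N. (\<Sum>l<k. s l b j * cnj (s l b i)) * residual k s b i j)"
    by (subst (1) residual_def) (simp add: left_diff_distrib sum_subtractf)
  also have "(\<Sum>i<N. (\<Sum>l<k. s l b j * cnj (s l b i)) * residual k s b i j)
      = (\<Sum>l<k. s l b j * (\<Sum>i<N. residual k s b i j * cnj (s l b i)))"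
    by (subst sum_distrib_right, subst sum.swap) (simp add: sum_distrib_left mult_ac)
  also have "\<dots> = 0"
    using residual_orthogonal assms by simp
  finally show ?thesis
    using residual_in_image[of b j j] assms by simp
qed

lemma residual_trace:
  assumes "b \<in> U"
  shows "(\<Sum>j<N. residual k s b j j) = of_nat n - of_nat k"
proof -
  have "(\<Sum>j<N. \<Sum>l<k. s l b j * cnj (s l b j)) = (\<Sum>l<k. 1)"
    by (subst sum.swap) (use local_frameD(3)[OF s] assms in simp)
  then show ?thesis
    using P_trace[of b] U assms by (auto simp: residual_def sum_subtractf)
qed

lemma residual_continuous:
  assumes "i < N" "j < N"
  shows "continuous_map (subtopology K U) euclidean (\<lambda>b. residual k s b i j)"
  unfolding residual_def using assms local_frameD(1)[OF s] P_continuous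
  by (intro continuous_map_diff continuous_map_sum continuous_map_mult_algebra continuous_map_cnj)
    (auto intro: continuous_map_from_subtopology)

text \<open>By the previous lemmas the squared moduli of all entries sum to the trace, which is \<open>0\<close>.\<close>

lemma residual_zero:
  assumes "k = n" "b \<in> U" "i < N" "j < N"
  shows "residual k s b i j = 0"
proof -
  have nn: "Re (residual k s b j j) = (\<Sum>i<N. (cmod (residual k s b i j))\<^sup>2)" if "j < N" for j
  proof -
    have "residual k s b j j = (\<Sum>i<N. of_real ((cmod (residual k s b i j))\<^sup>2))"
      unfolding residual_norm[OF assms(2) that, symmetric] by (simp only: complex_norm_square)
    then show ?thesis by simp
  qed
  have "(\<Sum>j<N. Re (residual k s b j j)) = Re (\<Sum>j<N. residual k s b j j)"
    by simp
  also have "\<dots> = 0"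
    using residual_trace[OF assms(2)] assms(1) by simp
  finally have "(\<Sum>j<N. \<Sum>i<N. (cmod (residual k s b i j))\<^sup>2) = 0"
    using nn by simp
  then have "(\<Sum>i<N. (cmod (residual k s b i j))\<^sup>2) = 0"
    using assms(4) by (subst (asm) sum_nonneg_eq_0_iff) (auto intro: sum_nonneg)
  then have "(cmod (residual k s b i j))\<^sup>2 = 0"
    using assms(3) by (subst (asm) sum_nonneg_eq_0_iff) auto
  then show ?thesis by simp
qed

end

text \<open>
  A diagonal entry \<open>R\<^sub>j\<^sub>j\<close> of the residual that is nonzero at \<open>b0\<close> stays nonzero nearby, and it is the
  squared norm of the \<open>j\<close>-th column. That column, normalised, is the next section.
\<close>

lemma ex_local_frame:
  assumes b0: "b0 \<in> topspace K"
  shows "k \<le> n \<Longrightarrow> \<exists>U s. openin K U \<and> b0 \<in> U \<and> local_frame U k s"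
proof (induction k)
  case 0
  then show ?case
    using b0 by (intro exI[of _ "topspace K"]) (auto simp: local_frame_def)
next
  case (Suc k)
  then obtain U s where U: "openin K U" "b0 \<in> U" and s: "local_frame U k s" by auto
  have UK: "U \<subseteq> topspace K" using U(1) openin_subset by blast
  let ?R = "residual k s"
  have "(\<Sum>j<N. ?R b0 j j) \<noteq> 0"
    using residual_trace[OF UK s U(2)] Suc.prems by simp
  then obtain j where j: "j < N" "?R b0 j j \<noteq> 0"
    using sum.neutral[of "{..<N}" "\<lambda>j. ?R b0 j j"] by blast
  define q where "q b = Re (?R b j j)" for b
  have q: "?R b j j = of_real (q b)" and q2: "q b = (\<Sum>i<N. (cmod (?R b i j))\<^sup>2)" if "b \<in> U" for b
  proof -
    have "?R b j j = (\<Sum>i<N. of_real ((cmod (?R b i j))\<^sup>2))"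
      unfolding residual_norm[OF UK s that j(1), symmetric] by (simp only: complex_norm_square)
    then show "?R b j j = of_real (q b)" "q b = (\<Sum>i<N. (cmod (?R b i j))\<^sup>2)"
      by (simp_all add: q_def)
  qed
  have qc: "continuous_map (subtopology K U) euclideanreal q"
    unfolding q_def by (intro continuous_map_Re residual_continuous UK s j)
  define U' where "U' = {b \<in> U. 0 < q b}"
  have "openin (subtopology K U) {b \<in> topspace (subtopology K U). q b \<in> {0<..}}"
    by (rule openin_continuous_map_preimage[OF qc]) auto
  then have "openin (subtopology K U) U'"
    using UK by (simp add: U'_def Int_absorb1)
  then have "openin K U'"
    using U(1) openin_trans_full by blast
  moreover have "b0 \<in> U'"
  proof -
    have "q b0 \<noteq> 0" using j(2) unfolding q[OF U(2)] by simp
    moreover have "0 \<le> q b0" unfolding q2[OF U(2)] by (intro sum_nonneg) simp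
    ultimately show ?thesis using U(2) by (simp add: U'_def)
  qed
  moreover define t where "t b i = of_real (inverse (sqrt (q b))) * ?R b i j" for b i
  define s' where "s' l = (if l = k then t else s l)" for l
  have sub: "U' \<subseteq> U" by (auto simp: U'_def)
  have tc: "continuous_map (subtopology K U') euclidean (\<lambda>b. t b i)" if "i < N" for i
    unfolding t_def
    using continuous_map_from_subtopology_mono[OF qc sub] UK
      continuous_map_from_subtopology_mono[OF residual_continuous[OF UK s that j(1)] sub]
    by (intro continuous_map_mult_algebra continuous_map_of_real continuous_map_inverse_sqrt)
      (auto simp: U'_def)
  have tP: "(\<Sum>m<N. P b i m * t b m) = t b i" if "b \<in> U'" "i < N" for b i
  proof -
    have "(\<Sum>m<N. P b i m * t b m) = of_real (inverse (sqrt (q b))) * (\<Sum>m<N. P b i m * ?R b m j)"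
      by (simp add: t_def sum_distrib_left mult.left_commute)
    then show ?thesis
      using residual_in_image[OF UK s, of b i j] that sub j by (auto simp: t_def)
  qed
  have ts: "(\<Sum>i<N. t b i * cnj (s m b i)) = 0" if "b \<in> U'" "m < k" for b m
  proof -
    have "(\<Sum>i<N. t b i * cnj (s m b i))
        = of_real (inverse (sqrt (q b))) * (\<Sum>i<N. ?R b i j * cnj (s m b i))"
      by (simp add: t_def sum_distrib_left mult.assoc)
    then show ?thesis
      using residual_orthogonal[OF UK s, of b j m] that sub j by auto
  qed
  have st: "(\<Sum>i<N. s m b i * cnj (t b i)) = 0" if "b \<in> U'" "m < k" for b m
  proof -
    have "(\<Sum>i<N. s m b i * cnj (t b i)) = cnj (\<Sum>i<N. t b i * cnj (s m b i))"
      by (simp add: mult.commute)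
    then show ?thesis using ts[OF that] by simp
  qed
  have tt: "(\<Sum>i<N. t b i * cnj (t b i)) = 1" if b: "b \<in> U'" for b
  proof -
    have "(\<Sum>i<N. t b i * cnj (t b i))
        = of_real (inverse (sqrt (q b)) * inverse (sqrt (q b))) * (\<Sum>i<N. ?R b i j * cnj (?R b i j))"
      by (simp add: t_def sum_distrib_left mult_ac)
    also have "(\<Sum>i<N. ?R b i j * cnj (?R b i j)) = of_real (q b)"
      using residual_norm[OF UK s, of b j] q[of b] b sub j by auto
    also have "of_real (inverse (sqrt (q b)) * inverse (sqrt (q b))) * of_real (q b) = (1::complex)"
    proof -
      have "inverse (sqrt (q b)) * inverse (sqrt (q b)) * q b = 1"
        using b by (simp add: U'_def field_simps)
      then show ?thesis by (metis of_real_1 of_real_mult)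
    qed
    finally show ?thesis .
  qed
  have "local_frame U' (Suc k) s'"
    unfolding local_frame_def
  proof (intro conjI allI impI ballI)
    fix l i assume "l < Suc k" "i < N"
    then show "continuous_map (subtopology K U') euclidean (\<lambda>b. s' l b i)"
      using tc continuous_map_from_subtopology_mono[OF local_frameD(1)[OF s] sub]
      by (auto simp: s'_def)
  next
    fix l i b assume "l < Suc k" "i < N" "b \<in> U'"
    then show "(\<Sum>j<N. P b i j * s' l b j) = s' l b i"
      using tP local_frameD(2)[OF s] sub by (auto simp: s'_def subset_iff)
  next
    fix l m b assume "l < Suc k" "m < Suc k" "b \<in> U'"
    then show "(\<Sum>i<N. s' l b i * cnj (s' m b i)) = (if l = m then 1 else 0)"
      using tt ts st local_frameD(3)[OF s] sub by (auto simp: s'_def subset_iff less_Suc_eq)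
  qed
  ultimately show ?case by blast
qed

text \<open>
  A local frame of full length gives mutually inverse maps: coefficients with respect to the frame, and
  linear combinations of it. That they are inverse is \<open>P = \<Sum>\<^sub>l s\<^sub>l s\<^sub>l\<^sup>*\<close>, the vanishing of the
  residual.
\<close>

lemma has_rank_W: "has_rank K W n"
  unfolding has_rank_def locally_trivial_at_def
proof
  fix b0 assume b0: "b0 \<in> topspace K"
  obtain U s where U: "openin K U" "b0 \<in> U" and s: "local_frame U n s"
    using ex_local_frame[OF b0, of n] by auto
  have UK: "U \<subseteq> topspace K" using U(1) openin_subset by blast
  define \<phi> where "\<phi> u = (fst u, \<lambda>l\<in>{..<n}. \<Sum>i<N. snd u i * cnj (s l (fst u) i))" for u :: "'k \<times> (nat \<Rightarrow> complex)"
  define \<psi> where "\<psi> c = (fst c, \<lambda>i\<in>{..<N}. \<Sum>l<n. snd c l * s l (fst c) i)" for c :: "'k \<times> (nat \<Rightarrow> complex)"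
  let ?E = "subtopology (total W) {u. proj W u \<in> U}"
  let ?F = "prod_topology (subtopology K U) (complex_space n)"
  have \<psi>im: "(\<lambda>i\<in>{..<N}. \<Sum>l<n. c l * s l b i) \<in> img b" if b: "b \<in> U" for b c
  proof -
    have "(\<Sum>j<N. P b i j * (\<Sum>l<n. c l * s l b j)) = (\<Sum>l<n. c l * s l b i)" if "i < N" for i
    proof -
      have "(\<Sum>j<N. P b i j * (\<Sum>l<n. c l * s l b j)) = (\<Sum>l<n. c l * (\<Sum>j<N. P b i j * s l b j))"
        by (subst sum_distrib_left, subst sum.swap) (simp add: sum_distrib_left mult.left_commute)
      then show ?thesis
        using local_frameD(2)[OF s _ that b] by simp
    qed
    then show ?thesis by (simp add: img_def cong: sum.cong_simp)
  qed
  have \<phi>c: "continuous_map ?E ?F \<phi>"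
  proof -
    have f: "continuous_map ?E (total W) (\<lambda>u. u)"
      by (simp add: continuous_map_from_subtopology)
    have "continuous_map (total W) K fst"
      by (auto simp: image_bundle_def continuous_map_fst intro!: continuous_map_from_subtopology)
    then have g: "continuous_map ?E (subtopology K U) fst"
      by (auto simp: continuous_map_in_subtopology ops_W intro: continuous_map_from_subtopology)
    have sc: "continuous_map ?E euclidean (\<lambda>u. s l (fst u) i)" if "l < n" "i < N" for l i
      using continuous_map_compose[OF g local_frameD(1)[OF s that]] by (simp add: o_def)
    have "continuous_map ?E euclidean (\<lambda>u. \<Sum>i<N. snd u i * cnj (s l (fst u) i))" if "l < n" for l
      using coordinate_continuous[OF f] sc[OF that]
      by (intro continuous_map_sum continuous_map_mult_algebra continuous_map_cnj) auto
    then have "continuous_map ?E (complex_space n) (\<lambda>u. \<lambda>l\<in>{..<n}. \<Sum>i<N. snd u i * cnj (s l (fst u) i))"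
      unfolding complex_space_def continuous_map_componentwise by auto
    then show ?thesis
      using g by (simp add: \<phi>_def continuous_map_pairwise o_def)
  qed
  have \<psi>c: "continuous_map ?F ?E \<psi>"
  proof -
    have g: "continuous_map ?F (subtopology K U) fst" and h: "continuous_map ?F (complex_space n) snd"
      by (auto simp: continuous_map_fst continuous_map_snd)
    have sc: "continuous_map ?F euclidean (\<lambda>u. s l (fst u) i)" if "l < n" "i < N" for l i
      using continuous_map_compose[OF g local_frameD(1)[OF s that]] by (simp add: o_def)
    have hc: "continuous_map ?F euclidean (\<lambda>u. snd u l)" if "l < n" for l
      using h that unfolding complex_space_def continuous_map_componentwise by auto
    have "continuous_map ?F (total W) \<psi>"
      unfolding \<psi>_def
    proof (rule continuous_into_total)
      show "continuous_map ?F K fst"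
        using g by (simp add: continuous_map_in_subtopology)
      show "continuous_map ?F euclidean (\<lambda>t. (\<lambda>i\<in>{..<N}. \<Sum>l<n. snd t l * s l (fst t) i) i)"
        if "i < N" for i
        using that by simp (intro continuous_map_sum continuous_map_mult_algebra, auto intro: sc hc)
    qed (use \<psi>im in auto)
    then show ?thesis
      by (auto simp: continuous_map_in_subtopology \<psi>_def ops_W)
  qed
  have \<phi>\<psi>: "\<phi> (\<psi> c) = c" if c: "c \<in> topspace ?F" for c
  proof -
    obtain b w where bw: "c = (b, w)" "b \<in> U" "w \<in> extensional {..<n}"
      using c by (auto simp: complex_space_def PiE_def)
    have "(\<Sum>i<N. (\<Sum>m<n. w m * s m b i) * cnj (s l b i)) = w l" if "l < n" for l
    proof -
      have "(\<Sum>i<N. (\<Sum>m<n. w m * s m b i) * cnj (s l b i))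
          = (\<Sum>m<n. w m * (\<Sum>i<N. s m b i * cnj (s l b i)))"
        by (subst sum_distrib_right, subst sum.swap) (simp add: sum_distrib_left mult.assoc)
      also have "\<dots> = (\<Sum>m<n. if m = l then w l else 0)"
        using local_frameD(3)[OF s _ that bw(2)] by (intro sum.cong) auto
      finally show ?thesis using that by simp
    qed
    then have "(\<lambda>l\<in>{..<n}. \<Sum>i<N. (\<lambda>i\<in>{..<N}. \<Sum>m<n. w m * s m b i) i * cnj (s l b i)) = w"
      using bw(3) by (intro extensionalityI[of _ "{..<n}"]) (auto cong: sum.cong_simp)
    then show ?thesis by (simp add: \<phi>_def \<psi>_def bw(1))
  qed
  have \<psi>\<phi>: "\<psi> (\<phi> u) = u" if u: "u \<in> topspace ?E" for u
  proof -
    obtain b w where bw: "u = (b, w)" "b \<in> U" "w \<in> img b"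
      using u by (auto simp: topspace_total ops_W)
    have "(\<Sum>l<n. (\<Sum>j<N. w j * cnj (s l b j)) * s l b i) = w i" if i: "i < N" for i
    proof -
      have "(\<Sum>l<n. (\<Sum>j<N. w j * cnj (s l b j)) * s l b i)
          = (\<Sum>j<N. (\<Sum>l<n. s l b i * cnj (s l b j)) * w j)"
        by (simp only: sum_distrib_right, subst sum.swap, simp add: mult_ac)
      also have "\<dots> = (\<Sum>j<N. P b i j * w j)"
        using residual_zero[OF UK s refl bw(2) i] by (intro sum.cong) (auto simp: residual_def)
      finally show ?thesis using image_fix[OF bw(3) i] by simp
    qed
    then have "(\<lambda>i\<in>{..<N}. \<Sum>l<n. (\<lambda>l\<in>{..<n}. \<Sum>j<N. w j * cnj (s l b j)) l * s l b i) = w"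
      using image_ext[OF bw(3)] by (intro extensionalityI[of _ "{..<N}"]) (auto cong: sum.cong_simp)
    then show ?thesis by (simp add: \<phi>_def \<psi>_def bw(1))
  qed
  have "homeomorphic_map ?E ?F \<phi>"
    unfolding homeomorphic_map_maps homeomorphic_maps_def using \<phi>c \<psi>c \<phi>\<psi> \<psi>\<phi> by blast
  moreover have "snd (\<phi> (vadd W u v)) l = snd (\<phi> u) l + snd (\<phi> v) l"
    if "b \<in> U" "u \<in> fibre W b" "v \<in> fibre W b" "l < n" for b u v l
    using that UK by (auto simp: fibre_W subset_iff \<phi>_def ops_W distrib_right sum.distrib cong: sum.cong_simp)
  moreover have "snd (\<phi> (vscale W c u)) l = c * snd (\<phi> u) l"
    if "b \<in> U" "u \<in> fibre W b" "l < n" for b c u l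
    using that UK by (auto simp: fibre_W subset_iff \<phi>_def ops_W sum_distrib_left mult.assoc cong: sum.cong_simp)
  moreover have "fst (\<phi> u) = b" if "b \<in> U" "u \<in> fibre W b" for b u
    using that by (auto simp: fibre_def \<phi>_def ops_W)
  ultimately have "local_trivialization K W U n \<phi>"
    unfolding local_trivialization_def by blast
  then show "\<exists>U \<phi>. openin K U \<and> b0 \<in> U \<and> local_trivialization K W U n \<phi>"
    using U by blast
qed

theorem vector_bundle_W: "vector_bundle K W"
  unfolding vector_bundle_def
proof (intro conjI ballI)
  show "continuous_map (total W) K (proj W)"
    by (auto simp: image_bundle_def continuous_map_fst intro!: continuous_map_from_subtopology)
  show "\<exists>k. locally_trivial_at K W k b" if "b \<in> topspace K" for b
    using has_rank_W that by (auto simp: has_rank_def)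
qed (use module_W inner_product_W inner_continuous_W in auto)

end

section \<open>Extension to a compactification\<close>

context hermitian_bundle begin

text \<open>
  The coefficient vector of any \<open>u\<close> is fixed by the Gram matrix. For \<open>u = s\<^sub>k\<close> this says that the Gram
  matrix is idempotent.
\<close>

lemma parseval_gram_idempotent:
  assumes "parseval_frame (topspace B) N s" "x \<in> topspace B" "i < N" "u \<in> fibre E x"
  shows "(\<Sum>j<N. vinner E (s j x) (s i x) * vinner E u (s j x)) = vinner E u (s i x)"
  using parseval_frameD(3)[OF assms(1,2,4) parseval_frameD(2)[OF assms(1,3,2)]]
  by (simp add: mult.commute)

text \<open>For a Parseval frame the squared moduli of all Gram entries sum to the trace \<open>n\<close>.\<close>

lemma parseval_gram_bound:
  assumes s: "parseval_frame (topspace B) N s" and x: "x \<in> topspace B"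
    and tr: "(\<Sum>i<N. vinner E (s i x) (s i x)) = of_nat n" and ij: "i < N" "j < N"
  shows "cmod (vinner E (s j x) (s i x)) \<le> sqrt n"
proof -
  have fib: "s i x \<in> fibre E x" if "i < N" for i
    using parseval_frameD(2)[OF s that x] .
  have "vinner E (s j x) (s j x) = (\<Sum>i<N. of_real ((cmod (vinner E (s j x) (s i x)))\<^sup>2))" if "j < N" for j
  proof -
    have "vinner E (s j x) (s j x) = (\<Sum>i<N. vinner E (s j x) (s i x) * vinner E (s i x) (s j x))"
      using parseval_frameD(3)[OF s x fib[OF that] fib[OF that]] .
    also have "\<dots> = (\<Sum>i<N. of_real ((cmod (vinner E (s j x) (s i x)))\<^sup>2))"
    proof (intro sum.cong refl)
      fix i assume "i \<in> {..<N}"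
      then have "vinner E (s i x) (s j x) = cnj (vinner E (s j x) (s i x))"
        using inner_commute[OF fib[OF that] fib[of i]] by simp
      then show "vinner E (s j x) (s i x) * vinner E (s i x) (s j x)
          = of_real ((cmod (vinner E (s j x) (s i x)))\<^sup>2)"
        by (simp only: complex_norm_square)
    qed
    finally show ?thesis .
  qed
  then have "complex_of_real (\<Sum>j<N. \<Sum>i<N. (cmod (vinner E (s j x) (s i x)))\<^sup>2) = of_real (real n)"
    using tr by simp
  then have *: "(\<Sum>j<N. \<Sum>i<N. (cmod (vinner E (s j x) (s i x)))\<^sup>2) = real n"
    unfolding of_real_eq_iff .
  have "(cmod (vinner E (s j x) (s i x)))\<^sup>2 \<le> (\<Sum>i<N. (cmod (vinner E (s j x) (s i x)))\<^sup>2)"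
    using ij by (intro member_le_sum) auto
  also have "\<dots> \<le> (\<Sum>j<N. \<Sum>i<N. (cmod (vinner E (s j x) (s i x)))\<^sup>2)"
    using ij by (intro member_le_sum[of j "{..<N}" "\<lambda>j. \<Sum>i<N. (cmod (vinner E (s j x) (s i x)))\<^sup>2"])
      (auto intro: sum_nonneg)
  finally show ?thesis
    unfolding * by (simp add: real_le_rsqrt)
qed

lemma gram_continuous:
  assumes s: "parseval_frame (topspace B) N s" and ij: "i < N" "j < N"
  shows "continuous_map B euclidean (\<lambda>x. vinner E (s j x) (s i x))"
proof (rule inner_continuous)
  show "proj E (s j x) = proj E (s i x)" if "x \<in> topspace B" for x
    using parseval_frameD(2)[OF s _ that] ij in_fibre(4) by metis
qed (use parseval_frameD(1)[OF s] ij in simp_all)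

text \<open>
  The defining equations of a projection of trace \<open>n\<close> hold on \<open>X\<close>, and they pass to its closure because
  both sides are continuous functions into a Hausdorff space.
\<close>

lemma projection_family_of_gram_extension:
  fixes K :: "'k topology"
  assumes s: "parseval_frame (topspace B) N s"
    and tr: "\<And>x. x \<in> topspace B \<Longrightarrow> (\<Sum>i<N. vinner E (s i x) (s i x)) = of_nat n"
    and e: "compactification B K e"
    and P: "\<And>i j. i < N \<Longrightarrow> j < N \<Longrightarrow> continuous_map K euclidean (\<lambda>b. P b i j)"
    and Pe: "\<And>x i j. \<lbrakk>x \<in> topspace B; i < N; j < N\<rbrakk> \<Longrightarrow> P (e x) i j = vinner E (s j x) (s i x)"
  shows "projection_family K N n P"
proof -
  have ext: "f b = g b"
    if "b \<in> topspace K" "continuous_map K euclidean f" "continuous_map K euclidean g"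
      "\<And>x. x \<in> topspace B \<Longrightarrow> f (e x) = g (e x)" for f g :: "'k \<Rightarrow> complex" and b
    using that e forall_in_closure_of_eq[of b K "e ` topspace B" euclidean f g]
    by (auto simp: compactification_def)
  have fib: "s i x \<in> fibre E x" if "i < N" "x \<in> topspace B" for i x
    using parseval_frameD(2)[OF s that] .
  show ?thesis
  proof
    fix b i j assume b: "b \<in> topspace K" and i: "i < N" and j: "j < N"
    show "(\<Sum>k<N. P b i k * P b k j) = P b i j"
      by (rule ext[OF b])
        (use i j in \<open>auto simp: Pe P parseval_gram_idempotent[OF s] fib
          intro!: continuous_map_sum continuous_map_mult_algebra\<close>)
    show "P b j i = cnj (P b i j)"
      by (rule ext[OF b])
        (use i j in \<open>auto simp: Pe P fib intro!: continuous_map_cnj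
          inner_commute[OF fib[OF j] fib[OF i]]\<close>)
  next
    fix b assume b: "b \<in> topspace K"
    show "(\<Sum>i<N. P b i i) = of_nat n"
      by (rule ext[OF b]) (auto simp: Pe P tr intro!: continuous_map_sum)
  qed (use P in auto)
qed

text \<open>
  The isomorphism sends \<open>u\<close> to its coefficients \<open>\<langle>u, s\<^sub>i\<rangle>\<close>, and its inverse sends \<open>w\<close> to
  \<open>\<Sum>\<^sub>i w\<^sub>i s\<^sub>i\<close>. The Parseval identity says both that the inverse recovers \<open>u\<close> and that the inner
  product is preserved; the other composite is the Gram matrix, which is the identity on its range.
\<close>

lemma isomorphic_pullback_image_bundle:
  fixes K :: "'k topology"
  assumes s: "parseval_frame (topspace B) N s" and e: "continuous_map B K e"
    and proj: "projection_family K N n P"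
    and Pe: "\<And>x i j. \<lbrakk>x \<in> topspace B; i < N; j < N\<rbrakk> \<Longrightarrow> P (e x) i j = vinner E (s j x) (s i x)"
  shows "bundle_isomorphic B E (pullback_bundle B e (image_bundle K N P))"
proof -
  interpret W: projection_family K N n P by fact
  have fib: "s i x \<in> fibre E x" if "i < N" "x \<in> topspace B" for i x
    using parseval_frameD(2)[OF s that] .
  have sc: "continuous_map B (total E) (s i)" if "i < N" for i
    using parseval_frameD(1)[OF s that] by simp
  have eK: "e x \<in> topspace K" if "x \<in> topspace B" for x
    using e that continuous_map_image_subset_topspace by fastforce
  let ?F = "pullback_bundle B e (image_bundle K N P)"
  define a where "a u = (\<lambda>i\<in>{..<N}. vinner E u (s i (proj E u)))" for u
  define f where "f u = (proj E u, (e (proj E u), a u))" for u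
  define g where "g y = fibre_sum E (fst y) (snd (snd y)) (\<lambda>i. s i (fst y)) N"
    for y :: "'b \<times> 'k \<times> (nat \<Rightarrow> complex)"
  have totF: "total ?F = subtopology (prod_topology B (total W.W)) {(x, u). fst u = e x}"
    by (simp add: pullback_bundle_def W.ops_W)
  have topF: "topspace (total ?F) = {(x, b, w). x \<in> topspace B \<and> b = e x \<and> w \<in> W.img (e x)}"
    unfolding totF using eK by (auto simp: W.topspace_total)
  have a: "a u \<in> W.img (e x)" if u: "u \<in> fibre E x" for u x
  proof -
    have x: "x \<in> topspace B" "proj E u = x" using in_fibre[of u] u by auto
    have "(\<Sum>j<N. P (e x) i j * vinner E u (s j x)) = vinner E u (s i x)" if "i < N" for i
      using parseval_gram_idempotent[OF s x(1) that u] Pe[OF x(1) that] by simp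
    then show ?thesis
      by (simp add: W.img_def a_def x(2) cong: sum.cong_simp)
  qed
  have idc: "continuous_map (total E) (total E) (\<lambda>u. u)" by simp
  have fc: "continuous_map (total E) (total ?F) f"
  proof -
    have "continuous_map (total E) (total W.W) (\<lambda>u. (e (proj E u), a u))"
    proof (rule W.continuous_into_total)
      show "continuous_map (total E) K (\<lambda>u. e (proj E u))"
        using continuous_map_compose[OF proj_continuous e] by (simp add: o_def)
      show "a u \<in> W.img (e (proj E u))" if "u \<in> topspace (total E)" for u
        using a in_fibre(5) that by blast
      show "continuous_map (total E) euclidean (\<lambda>u. a u i)" if i: "i < N" for i
      proof -
        have "continuous_map (total E) euclidean (\<lambda>u. vinner E u (s i (proj E u)))"
        proof (rule inner_continuous[OF idc])
          show "continuous_map (total E) (total E) (\<lambda>u. s i (proj E u))"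
            using continuous_map_compose[OF proj_continuous sc[OF i]] by (simp add: o_def)
          show "proj E u = proj E (s i (proj E u))" if "u \<in> topspace (total E)" for u
            using in_fibre(4)[OF fib[OF i in_fibre(1)[OF that]]] by simp
        qed
        then show ?thesis using i by (simp add: a_def)
      qed
    qed
    then have "continuous_map (total E) (prod_topology B (total W.W))
        (\<lambda>u. (proj E u, (e (proj E u), a u)))"
      using proj_continuous by (simp add: continuous_map_paired)
    then show ?thesis
      unfolding totF f_def[abs_def] by (auto simp: continuous_map_in_subtopology)
  qed
  have gc: "continuous_map (total ?F) (total E) g"
    unfolding g_def
  proof (rule fibre_sum_continuous)
    show fst: "continuous_map (total ?F) B fst"
      unfolding totF by (auto intro: continuous_map_from_subtopology continuous_map_fst)
    have "continuous_map (total ?F) (total W.W) snd"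
      unfolding totF by (auto intro: continuous_map_from_subtopology continuous_map_snd)
    then show "continuous_map (total ?F) euclidean (\<lambda>y. snd (snd y) i)" if "i < N" for i
      using W.coordinate_continuous that by blast
    show "continuous_map (total ?F) (total E) (\<lambda>y. s i (fst y))" if "i < N" for i
      using continuous_map_compose[OF fst sc[OF that]] by (simp add: o_def)
    show "s i (fst y) \<in> fibre E (fst y)" if "y \<in> topspace (total ?F)" "i < N" for y i
      using that fib unfolding topF by auto
  qed
  have gf: "g (f u) = u" if u: "u \<in> topspace (total E)" for u
  proof -
    let ?x = "proj E u"
    have x: "?x \<in> topspace B" and ux: "u \<in> fibre E ?x" using in_fibre u by auto
    have "fibre_sum E ?x (a u) (\<lambda>i. s i ?x) N = u"
    proof (rule fibre_eqI[OF _ ux])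
      show "fibre_sum E ?x (a u) (\<lambda>i. s i ?x) N \<in> fibre E ?x"
        using x fib by (intro fibre_sum_in_fibre) auto
      show "vinner E (fibre_sum E ?x (a u) (\<lambda>i. s i ?x) N) w = vinner E u w" if w: "w \<in> fibre E ?x" for w
        using parseval_frameD(3)[OF s x ux w] inner_fibre_sum_left[OF w, of N "\<lambda>i. s i ?x" "a u"] fib[OF _ x]
        by (simp add: a_def)
    qed
    then show ?thesis by (simp add: g_def f_def)
  qed
  have fg: "f (g y) = y" if yF: "y \<in> topspace (total ?F)" for y
  proof -
    obtain x w where y: "y = (x, e x, w)" and x: "x \<in> topspace B" and w: "w \<in> W.img (e x)"
      using yF unfolding topF by auto
    have gx: "g y \<in> fibre E x"
      unfolding g_def y using x fib by (auto intro!: fibre_sum_in_fibre)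
    then have px: "proj E (g y) = x" by (rule in_fibre(4))
    have "vinner E (g y) (s i x) = w i" if "i < N" for i
    proof -
      have "vinner E (g y) (s i x) = (\<Sum>j<N. w j * vinner E (s j x) (s i x))"
        unfolding g_def y using fib x that by (simp add: inner_fibre_sum_left[of _ x])
      also have "\<dots> = (\<Sum>j<N. P (e x) i j * w j)"
        using Pe[OF x that] by (intro sum.cong) auto
      finally show ?thesis using W.image_fix[OF w that] by simp
    qed
    then have "a (g y) = w"
      using W.image_ext[OF w] by (intro extensionalityI[of _ "{..<N}"]) (auto simp: a_def px)
    then show ?thesis using px by (simp add: f_def y)
  qed
  have parseval: "(\<Sum>i<N. vinner E u (s i x) * cnj (vinner E v (s i x))) = vinner E u v"
    if "x \<in> topspace B" "u \<in> fibre E x" "v \<in> fibre E x" for x u v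
    unfolding parseval_frameD(3)[OF s that]
    using inner_commute[OF that(3) fib[OF _ that(1)]] by (intro sum.cong) auto
  show ?thesis
    unfolding bundle_isomorphic_def
  proof (intro exI[of _ f] conjI ballI allI)
    show "homeomorphic_map (total E) (total ?F) f"
      unfolding homeomorphic_map_maps homeomorphic_maps_def using fc gc gf fg by blast
  next
    fix x u assume x: "x \<in> topspace B" and u: "u \<in> fibre E x"
    note pu = in_fibre(4)[OF u]
    show "proj ?F (f u) = x"
      by (simp add: pullback_bundle_def f_def pu)
    show "f (vscale E c u) = vscale ?F c (f u)" for c
      using scale_in_fibre[OF u] u fib[OF _ x]
      by (auto simp: pullback_bundle_def f_def a_def W.ops_W pu in_fibre(4)[OF scale_in_fibre[OF u]]
          inner_scale_left[of _ x] intro!: restrict_ext)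
    fix v assume v: "v \<in> fibre E x"
    note pv = in_fibre(4)[OF v]
    show "f (vadd E u v) = vadd ?F (f u) (f v)"
      using u v fib[OF _ x]
      by (auto simp: pullback_bundle_def f_def a_def W.ops_W pu pv in_fibre(4)[OF add_in_fibre[OF u v]]
          inner_add_left[of _ x] intro!: restrict_ext)
    show "vinner ?F (f u) (f v) = vinner E u v"
      using parseval[OF x u v]
      by (simp add: pullback_bundle_def f_def a_def W.ops_W pu pv cong: sum.cong_simp)
  qed
qed

lemma extension_of_bundle:
  assumes s: "parseval_frame (topspace B) N s"
    and tr: "\<And>x. x \<in> topspace B \<Longrightarrow> (\<Sum>i<N. vinner E (s i x) (s i x)) = of_nat n"
    and e: "compactification B K e"
    and P: "\<And>i j. i < N \<Longrightarrow> j < N \<Longrightarrow> continuous_map K euclidean (\<lambda>b. P b i j)"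
    and Pe: "\<And>x i j. \<lbrakk>x \<in> topspace B; i < N; j < N\<rbrakk> \<Longrightarrow> P (e x) i j = vinner E (s j x) (s i x)"
  shows "vector_bundle K (image_bundle K N P) \<and> has_rank K (image_bundle K N P) n \<and>
    bundle_isomorphic B E (pullback_bundle B e (image_bundle K N P))"
proof -
  have pf: "projection_family K N n P"
    by (rule projection_family_of_gram_extension[OF s tr e P Pe])
  then interpret W: projection_family K N n P .
  have "continuous_map B K e"
    using e homeomorphic_imp_continuous_map
    by (fastforce simp: compactification_def embedding_map_def continuous_map_in_subtopology)
  then show ?thesis
    using W.vector_bundle_W W.has_rank_W isomorphic_pullback_image_bundle[OF s _ pf Pe] by blast
qed

end

text \<open>
  Interleave a sequence that embeds \<open>X\<close> into \<open>\<real>\<^sup>\<nat>\<close> with the functions \<open>q\<^sub>k\<close>. The result still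
  embeds \<open>X\<close>, now with \<open>q\<^sub>k\<close> as the restriction of a coordinate, and the closure of the image is
  compact because all coordinates are bounded.
\<close>

lemma metrizable_compactification_extending:
  fixes q :: "nat \<Rightarrow> 'a \<Rightarrow> real"
  assumes top: "second_countable X" "normal_space X" "regular_space X" "t1_space X"
    and q: "\<And>k. continuous_map X euclideanreal (q k)"
    and R: "\<And>k x. x \<in> topspace X \<Longrightarrow> \<bar>q k x\<bar> \<le> R"
  shows "\<exists>K (e :: 'a \<Rightarrow> nat \<Rightarrow> real) h. compactification X K e \<and> metrizable_space K \<and>
    (\<forall>k. continuous_map K euclideanreal (h k) \<and> (\<forall>x\<in>topspace X. h k (e x) = q k x))"
proof -
  obtain F :: "nat \<Rightarrow> 'a \<Rightarrow> real" where F: "\<And>k. continuous_map X (top_of_set {0..1}) (F k)"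
    "\<And>U x. openin X U \<and> x \<in> U \<Longrightarrow> \<exists>k. F k x = 1 \<and> (\<forall>y\<in>topspace X - U. F k y = 0)"
    using second_countable_separating_sequence[OF top(1-3)] by metis
  define e where "e x k = (if even k then F (k div 2) x else q (k div 2) x)" for x k
  have emb: "embedding_map X euclidean e"
    unfolding e_def
  proof (rule embedding_map_of_separating_sequence)
    show "continuous_map X euclideanreal (\<lambda>x. if even k then F (k div 2) x else q (k div 2) x)" for k
      using F(1) q by (auto simp: continuous_map_in_subtopology)
    fix U x assume "openin X U" "x \<in> U"
    then obtain k where "F k x = 1 \<and> (\<forall>y\<in>topspace X - U. F k y = 0)"
      using F(2) by blast
    then show "\<exists>k. (if even k then F (k div 2) x else q (k div 2) x) = 1 \<and>
        (\<forall>y\<in>topspace X - U. (if even k then F (k div 2) y else q (k div 2) y) = 0)"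
      by (intro exI[of _ "2 * k"]) auto
  qed (rule top(4))
  define C where "C = closure (e ` topspace X)"
  define K where "K = top_of_set C"
  have sub: "e ` topspace X \<subseteq> C" by (simp add: C_def closure_subset)
  define S where "S = {- max 1 R..max 1 R}"
  have "compactin (product_topology (\<lambda>_::nat. euclideanreal) UNIV) (PiE UNIV (\<lambda>_. S))"
    by (simp add: compactin_PiE S_def)
  then have cS: "compact (PiE (UNIV :: nat set) (\<lambda>_. S))"
    unfolding euclidean_product_topology by simp
  have "e x k \<in> S" if x: "x \<in> topspace X" for k x
  proof (cases "even k")
    case True
    have "F (k div 2) x \<in> {0..1}"
      using F(1)[of "k div 2"] x by (auto simp: continuous_map_in_subtopology)
    then show ?thesis using True by (auto simp: e_def S_def)
  next
    case False
    then show ?thesis using R[OF x, of "k div 2"] by (auto simp: e_def S_def)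
  qed
  then have "e ` topspace X \<subseteq> PiE UNIV (\<lambda>_. S)"
    by auto
  then have "C \<subseteq> PiE UNIV (\<lambda>_. S)"
    unfolding C_def using cS by (simp add: closure_minimal compact_imp_closed)
  then have "compact C"
    using cS compact_Int_closed[of "PiE UNIV (\<lambda>_. S)" C] by (simp add: C_def Int_absorb1)
  then have "compactification X K e"
    unfolding compactification_def K_def using emb sub
    by (auto simp: compact_space_subtopology Hausdorff_space_subtopology embedding_map_in_subtopology
        closure_of_subtopology Int_absorb1 C_def)
  moreover have "metrizable_space K"
    by (simp add: K_def metrizable_space_subtopology metrizable_space_euclidean)
  moreover have "continuous_map K euclideanreal (\<lambda>w. w (2 * k + 1))" for k
    unfolding K_def by (auto intro!: continuous_on_product_coordinates[THEN continuous_on_subset])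
  moreover have "e x (2 * k + 1) = q k x" for x k
    by (simp add: e_def)
  ultimately show ?thesis
    by (intro exI[of _ K] exI[of _ e] exI[of _ "\<lambda>k w. w (2 * k + 1)"]) auto
qed

theorem theorem4p1:
  fixes X :: "'a topology" and V :: "('a, 'e) vbundle" and n :: nat
  assumes "second_countable X" and "locally_compact_space X" and "Hausdorff_space X"
    and "finite_covering_dim X"
    and "vector_bundle X V" and "has_rank X V n"
  shows "(\<exists>W :: (('a \<Rightarrow> real) \<Rightarrow> real, (('a \<Rightarrow> real) \<Rightarrow> real) \<times> (nat \<Rightarrow> complex)) vbundle.
            vector_bundle (stone_cech X) W \<and> has_rank (stone_cech X) W n \<and>
            bundle_isomorphic X V (pullback_bundle X (stone_cech_map X) W))
       \<and> (\<exists>(K :: (nat \<Rightarrow> real) topology) (e :: 'a \<Rightarrow> (nat \<Rightarrow> real))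
            (W :: (nat \<Rightarrow> real, (nat \<Rightarrow> real) \<times> (nat \<Rightarrow> complex)) vbundle).
            compactification X K e \<and> metrizable_space K \<and> vector_bundle K W \<and>
            bundle_isomorphic X V (pullback_bundle X e W))"
proof -
  interpret hermitian_bundle X V
    by unfold_locales fact
  have reg: "regular_space X"
    using assms(2,3) locally_compact_Hausdorff_imp_regular_space by blast
  have nor: "normal_space X"
    using reg assms(1) by (simp add: regular_Lindelof_imp_normal_space second_countable_imp_Lindelof_space)
  have t1: "t1_space X"
    using assms(3) by (simp add: Hausdorff_imp_t1_space)
  have cr: "completely_regular_space X"
    using nor reg by (simp add: normal_imp_completely_regular_space)
  note top = assms(1) nor reg t1
  obtain d where d: "covering_dim_le X d"
    using assms(4) by (auto simp: finite_covering_dim_def)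
  obtain N s where s: "parseval_frame (topspace X) N s"
    and tr: "\<And>x. x \<in> topspace X \<Longrightarrow> (\<Sum>i<N. vinner V (s i x) (s i x)) = of_nat n"
    using finite_parseval_frame[OF top d assms(6)] by blast
  define G where "G i j x = vinner V (s j x) (s i x)" for i j x
  have Gc: "continuous_map X euclidean (G i j)" if "i < N" "j < N" for i j
    unfolding G_def using gram_continuous[OF s that] .
  have Gb: "cmod (G i j x) \<le> sqrt n" if "x \<in> topspace X" "i < N" "j < N" for i j x
    unfolding G_def using parseval_gram_bound[OF s that(1) tr[OF that(1)] that(2,3)] .
  show ?thesis
  proof
    have "\<exists>h. continuous_map (stone_cech X) euclidean h \<and>
        (\<forall>x\<in>topspace X. h (stone_cech_map X x) = G i j x)" if ij: "i < N" "j < N" for i j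
    proof -
      have "continuous_map X (top_of_set (cball 0 (sqrt n))) (G i j)"
        using Gc[OF ij] Gb[OF _ ij] by (auto simp: continuous_map_in_subtopology)
      then obtain h where "continuous_map (stone_cech X) (top_of_set (cball 0 (sqrt n))) h"
          "\<And>x. x \<in> topspace X \<Longrightarrow> h (stone_cech_map X x) = G i j x"
        using stone_cech_extension[of "top_of_set (cball 0 (sqrt n))" X "G i j"]
        by (auto simp: compact_space_subtopology Hausdorff_space_subtopology)
      then show ?thesis
        by (auto simp: continuous_map_in_subtopology)
    qed
    then obtain h where h: "\<And>i j. i < N \<Longrightarrow> j < N \<Longrightarrow> continuous_map (stone_cech X) euclidean (h i j)"
        "\<And>i j x. i < N \<Longrightarrow> j < N \<Longrightarrow> x \<in> topspace X \<Longrightarrow> h i j (stone_cech_map X x) = G i j x"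
      by metis
    show "\<exists>W :: (('a \<Rightarrow> real) \<Rightarrow> real, (('a \<Rightarrow> real) \<Rightarrow> real) \<times> (nat \<Rightarrow> complex)) vbundle.
            vector_bundle (stone_cech X) W \<and> has_rank (stone_cech X) W n \<and>
            bundle_isomorphic X V (pullback_bundle X (stone_cech_map X) W)"
      using extension_of_bundle[OF s tr compactification_stone_cech[OF cr assms(3)],
          of "\<lambda>b i j. h i j b"] h
      by (auto simp: G_def)
  next
    \<comment> \<open>All real and imaginary parts of the Gram entries, listed as one sequence of real functions.\<close>
    define q where "q k x = (case from_nat k of (i, j, c) \<Rightarrow>
        if i < N \<and> j < N then if c then Re (G i j x) else Im (G i j x) else 0)" for k x
    have qc: "continuous_map X euclideanreal (q k)" for k
      unfolding q_def using Gc
      by (cases "from_nat k :: nat \<times> nat \<times> bool") (auto intro!: continuous_map_Re continuous_map_Im)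
    have qb: "\<bar>q k x\<bar> \<le> sqrt n" if "x \<in> topspace X" for k x
      unfolding q_def by (cases "from_nat k :: nat \<times> nat \<times> bool")
        (auto intro!: order_trans[OF abs_Re_le_cmod] order_trans[OF abs_Im_le_cmod] Gb[OF that])
    obtain K and e :: "'a \<Rightarrow> nat \<Rightarrow> real" and h where K: "compactification X K e" "metrizable_space K"
      and h: "\<And>k. continuous_map K euclideanreal (h k)"
        "\<And>k x. x \<in> topspace X \<Longrightarrow> h k (e x) = q k x"
      using metrizable_compactification_extending[where q = q and R = "sqrt n", OF top qc qb] by blast
    define P where "P b i j = of_real (h (to_nat (i, j, True)) b)
        + \<i> * of_real (h (to_nat (i, j, False)) b)" for b and i j :: nat
    have "continuous_map K euclidean (\<lambda>b. P b i j)" for i j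
      unfolding P_def using h(1)
      by (intro continuous_map_add continuous_map_mult_algebra continuous_map_of_real) auto
    moreover have "P (e x) i j = vinner V (s j x) (s i x)" if "x \<in> topspace X" "i < N" "j < N" for x i j
      using that h(2) by (simp add: P_def q_def complex_eq_iff flip: G_def)
    ultimately show "\<exists>(K :: (nat \<Rightarrow> real) topology) (e :: 'a \<Rightarrow> (nat \<Rightarrow> real))
            (W :: (nat \<Rightarrow> real, (nat \<Rightarrow> real) \<times> (nat \<Rightarrow> complex)) vbundle).
            compactification X K e \<and> metrizable_space K \<and> vector_bundle K W \<and>
            bundle_isomorphic X V (pullback_bundle X e W)"
      using K extension_of_bundle[OF s tr K(1), of P] by blast
  qed
qed

end
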